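(* Let $\Omega=(0,1)$, $T>0$, and $0=t_0<t_1<\dots<t_n<T$. Let $\mathcal H=H_0^1(\Omega)\times L^2(\Omega)$ and let $\mathcal A$ be the operator $\mathcal A(u,v)^\top=(v,\partial_x^2u)^\top$ with domain $\mathcal D(\mathcal A)=(H^2(\Omega)\cap H_0^1(\Omega))\times H_0^1(\Omega)$, which generates a group of isometries $(S(t))_{t\in\mathbb R}$ on $\mathcal H$. Assume that $\Psi_0=(\kappa^0,\kappa^1)^\top\in\mathcal D(\mathcal A)$ and that $\Upsilon_k\in H_0^1(\Omega)$ for $k=1,\dots,n$. Then the impulsive system $$\begin{cases}\partial_t\Psi(\cdot,t)=\mathcal A\Psi(\cdot,t), & t\in(0,T)\setminus\{t_1,\dots,t_n\},\\ \Psi(t_k^+)=\Psi(t_k^-)+\Upsilon_k B, & k=1,\dots,n,\\ \Psi(0)=\Psi_0,\end{cases}$$ where $B=(0,1)^\top$ (so that $\Upsilon_kB=(0,\Upsilon_k)^\top$), has a unique classical solution $\Psi$, and for $t\in[0,T)$ it satisfies $$\Psi(t)=S(t)\Psi_0+\sum_{0<t_k<t}S(t-t_k)\Upsilon_kB.$$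
   Context: $\mathcal H$ carries the inner product $((u,v)^\top,(\tilde u,\tilde v)^\top)_{\mathcal H}=\int_\Omega \partial_x u\,\overline{\partial_x\tilde u}\,dx+\int_\Omega v\,\overline{\tilde v}\,dx$; $\mathcal A$ is skew-adjoint on $\mathcal H$. $\Psi(t_k^\pm)$ denote the right and left limits of $\Psi$ at $t_k$. $\mathcal{PC}([0,T];\mathcal H)$ is the space of functions $y:[0,T]\to\mathcal H$ that are continuous on $[0,T]\setminus\{t_1,\dots,t_n\}$ and such that for every $k$ the limits $y(t_k^-)$ and $y(t_k^+)$ exist and $y(t_k)=y(t_k^-)$, with the norm $\|y\|=\sup_{t\in[0,T]}\|y(t)\|$. A classical solution of the system is a function $\Psi\in\mathcal{PC}([0,T];\mathcal H)\cap C^1\big((0,T)\setminus\{t_1,\dots,t_n\};\mathcal H\big)$ with $\Psi(t)\in\mathcal D(\mathcal A)$ for $t\in(0,T)\setminus\{t_1,\dots,t_n\}$ that satisfies the system (differential equation, jump conditions and initial condition) on $[0,T)$. *)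

theory Defs
  imports "HOL-Analysis.Analysis"
begin

section \<open>Complex inner product spaces\<close>

class complex_inner = real_inner +
  fixes scaleC :: "complex \<Rightarrow> 'a \<Rightarrow> 'a" (infixr "*\<^sub>C" 75)
    and cinner :: "'a \<Rightarrow> 'a \<Rightarrow> complex"
  assumes scaleC_add_right: "a *\<^sub>C (x + y) = a *\<^sub>C x + a *\<^sub>C y"
    and scaleC_add_left: "(a + b) *\<^sub>C x = a *\<^sub>C x + b *\<^sub>C x"
    and scaleC_scaleC: "a *\<^sub>C b *\<^sub>C x = (a * b) *\<^sub>C x"
    and scaleC_of_real: "of_real r *\<^sub>C x = r *\<^sub>R x"
    and cinner_commute: "cinner x y = cnj (cinner y x)"
    and cinner_add_left: "cinner (x + y) z = cinner x z + cinner y z"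
    and cinner_scaleC_left: "cinner (a *\<^sub>C x) y = a * cinner x y"
    and inner_eq_Re_cinner: "inner x y = Re (cinner x y)"

instantiation prod :: (complex_inner, complex_inner) complex_inner
begin

definition scaleC_prod_def: "a *\<^sub>C p = (a *\<^sub>C fst p, a *\<^sub>C snd p)"
definition cinner_prod_def: "cinner p q = cinner (fst p) (fst q) + cinner (snd p) (snd q)"

instance
proof
  fix a b :: complex and r :: real and x y z :: "'a \<times> 'b"
  show "a *\<^sub>C (x + y) = a *\<^sub>C x + a *\<^sub>C y" by (simp add: scaleC_prod_def scaleC_add_right)
  show "(a + b) *\<^sub>C x = a *\<^sub>C x + b *\<^sub>C x" by (simp add: scaleC_prod_def scaleC_add_left)
  show "a *\<^sub>C b *\<^sub>C x = (a * b) *\<^sub>C x" by (simp add: scaleC_prod_def scaleC_scaleC)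
  show "of_real r *\<^sub>C x = r *\<^sub>R x" by (simp add: scaleC_prod_def scaleC_of_real scaleR_prod_def)
  show "cinner x y = cnj (cinner y x)"
    unfolding cinner_prod_def complex_cnj_add by (metis cinner_commute)
  show "cinner (x + y) z = cinner x z + cinner y z"
    by (simp add: cinner_prod_def cinner_add_left)
  show "cinner (a *\<^sub>C x) y = a * cinner x y"
    by (simp add: cinner_prod_def scaleC_prod_def cinner_scaleC_left algebra_simps)
  show "inner x y = Re (cinner x y)"
    by (simp add: cinner_prod_def inner_prod_def inner_eq_Re_cinner)
qed

end


section \<open>The space of square-integrable functions on (0,1)\<close>

text \<open>Borel representatives suffice: every Lebesgue measurable function agrees almost everywhere with a
  Borel one, so the quotient below is the usual space $L^2(0,1)$.\<close>

definition Omega :: "real set" where "Omega = {0<..<1}"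

definition Omega_measure :: "real measure" where
  "Omega_measure = restrict_space lborel Omega"

definition square_integrable :: "(real \<Rightarrow> complex) \<Rightarrow> bool" where
  "square_integrable f \<longleftrightarrow> f \<in> borel_measurable Omega_measure \<and>
     integrable Omega_measure (\<lambda>x. (norm (f x))\<^sup>2)"

lemma square_integrable_measurable:
  "square_integrable f \<Longrightarrow> f \<in> borel_measurable Omega_measure"
  by (simp add: square_integrable_def)

lemma square_integrable_zero: "square_integrable (\<lambda>_. 0)"
  by (simp add: square_integrable_def)

lemma square_integrable_scale:
  assumes "square_integrable f" shows "square_integrable (\<lambda>x. c * f x)"
  using assms by (auto simp: square_integrable_def norm_mult power_mult_distrib)

lemma square_integrable_mult:
  assumes f: "square_integrable f" and g: "square_integrable g"
  shows "integrable Omega_measure (\<lambda>x. f x * g x)"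
proof (rule Bochner_Integration.integrable_bound)
  show "integrable Omega_measure (\<lambda>x. (norm (f x))\<^sup>2 + (norm (g x))\<^sup>2)"
    using f g by (auto simp: square_integrable_def)
  show "(\<lambda>x. f x * g x) \<in> borel_measurable Omega_measure"
    using f g by (auto simp: square_integrable_def)
  have "norm (f x * g x) \<le> norm ((norm (f x))\<^sup>2 + (norm (g x))\<^sup>2)" for x
  proof -
    have "2 * (norm (f x) * norm (g x)) \<le> (norm (f x))\<^sup>2 + (norm (g x))\<^sup>2"
      using sum_squares_bound[of "norm (f x)" "norm (g x)"] by (simp add: mult.assoc)
    moreover have "0 \<le> norm (f x) * norm (g x)" by simp
    ultimately have "norm (f x) * norm (g x) \<le> (norm (f x))\<^sup>2 + (norm (g x))\<^sup>2" by linarith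
    then show ?thesis by (simp add: norm_mult)
  qed
  then show "AE x in Omega_measure. norm (f x * g x) \<le> norm ((norm (f x))\<^sup>2 + (norm (g x))\<^sup>2)"
    by simp
qed

lemma borel_measurable_cnj [measurable (raw)]:
  "f \<in> borel_measurable M \<Longrightarrow> (\<lambda>x. cnj (f x)) \<in> borel_measurable M"
  by (rule borel_measurable_continuous_on[of cnj]) (intro continuous_intros)

lemma square_integrable_cnj:
  assumes "square_integrable f" shows "square_integrable (\<lambda>x. cnj (f x))"
  using assms by (auto simp: square_integrable_def)

lemma square_integrable_add:
  assumes f: "square_integrable f" and g: "square_integrable g"
  shows "square_integrable (\<lambda>x. f x + g x)"
  unfolding square_integrable_def
proof
  show m: "(\<lambda>x. f x + g x) \<in> borel_measurable Omega_measure"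
    using f g by (auto simp: square_integrable_def)
  show "integrable Omega_measure (\<lambda>x. (norm (f x + g x))\<^sup>2)"
  proof (rule Bochner_Integration.integrable_bound)
    show "integrable Omega_measure (\<lambda>x. 2 * (norm (f x))\<^sup>2 + 2 * (norm (g x))\<^sup>2)"
      using f g by (auto simp: square_integrable_def)
    show "(\<lambda>x. (norm (f x + g x))\<^sup>2) \<in> borel_measurable Omega_measure"
      using m by measurable
    have "(norm (f x + g x))\<^sup>2 \<le> 2 * (norm (f x))\<^sup>2 + 2 * (norm (g x))\<^sup>2" for x
    proof -
      have "(norm (f x + g x))\<^sup>2 \<le> (norm (f x) + norm (g x))\<^sup>2"
        by (intro power_mono norm_triangle_ineq) simp
      also have "\<dots> \<le> 2 * (norm (f x))\<^sup>2 + 2 * (norm (g x))\<^sup>2"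
        using sum_squares_bound[of "norm (f x)" "norm (g x)"] by (simp add: power2_sum)
      finally show ?thesis .
    qed
    then show "AE x in Omega_measure. norm ((norm (f x + g x))\<^sup>2)
        \<le> norm (2 * (norm (f x))\<^sup>2 + 2 * (norm (g x))\<^sup>2)"
      by simp
  qed
qed

definition l2_rel :: "(real \<Rightarrow> complex) \<Rightarrow> (real \<Rightarrow> complex) \<Rightarrow> bool" where
  "l2_rel f g \<longleftrightarrow> square_integrable f \<and> square_integrable g \<and> (AE x in Omega_measure. f x = g x)"

quotient_type l2 = "real \<Rightarrow> complex" / partial: l2_rel
proof (rule part_equivpI)
  show "\<exists>f. l2_rel f f"
    using square_integrable_zero by (auto simp: l2_rel_def)
  show "symp l2_rel"
    by (auto simp: symp_def l2_rel_def)
  show "transp l2_rel"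
    by (auto simp: transp_def l2_rel_def)
qed

instantiation l2 :: complex_inner
begin

lift_definition zero_l2 :: l2 is "\<lambda>_. 0"
  by (simp add: l2_rel_def square_integrable_zero)

lift_definition plus_l2 :: "l2 \<Rightarrow> l2 \<Rightarrow> l2" is "\<lambda>f g x. f x + g x"
  by (auto simp: l2_rel_def square_integrable_add)

lift_definition scaleC_l2 :: "complex \<Rightarrow> l2 \<Rightarrow> l2" is "\<lambda>c f x. c * f x"
  by (auto simp: l2_rel_def square_integrable_scale)

definition scaleR_l2 :: "real \<Rightarrow> l2 \<Rightarrow> l2" where "scaleR_l2 r u = of_real r *\<^sub>C u"
definition uminus_l2 :: "l2 \<Rightarrow> l2" where "uminus_l2 u = (-1) *\<^sub>C u"
definition minus_l2 :: "l2 \<Rightarrow> l2 \<Rightarrow> l2" where "minus_l2 u v = u + - v"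

lift_definition cinner_l2 :: "l2 \<Rightarrow> l2 \<Rightarrow> complex" is
  "\<lambda>f g. LINT x|Omega_measure. f x * cnj (g x)"
proof -
  fix f f' g g' :: "real \<Rightarrow> complex"
  assume "l2_rel f f'" "l2_rel g g'"
  then show "(LINT x|Omega_measure. f x * cnj (g x)) = (LINT x|Omega_measure. f' x * cnj (g' x))"
    by (intro integral_cong_AE) (auto simp: l2_rel_def square_integrable_def)
qed

definition inner_l2 :: "l2 \<Rightarrow> l2 \<Rightarrow> real" where "inner_l2 u v = Re (cinner u v)"
definition norm_l2 :: "l2 \<Rightarrow> real" where "norm_l2 u = sqrt (inner u u)"
definition sgn_l2 :: "l2 \<Rightarrow> l2" where "sgn_l2 u = inverse (norm u) *\<^sub>R u"
definition dist_l2 :: "l2 \<Rightarrow> l2 \<Rightarrow> real" where "dist_l2 u v = norm (u - v)"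
definition uniformity_l2 :: "(l2 \<times> l2) filter" where
  "uniformity_l2 = (INF e\<in>{0<..}. principal {(x, y). dist x y < e})"
definition open_l2 :: "l2 set \<Rightarrow> bool" where
  "open_l2 U \<longleftrightarrow> (\<forall>x\<in>U. eventually (\<lambda>(x', y). x' = x \<longrightarrow> y \<in> U) uniformity)"

instance
proof
  fix a b :: complex and r s :: real and x y z :: l2
  show add_assoc: "x + y + z = x + (y + z)"
    by transfer (auto simp: l2_rel_def add.assoc intro!: square_integrable_add)
  show "x + y = y + x"
    by transfer (auto simp: l2_rel_def add.commute intro!: square_integrable_add)
  show "0 + x = x"
    by transfer (auto simp: l2_rel_def)
  show "- x + x = 0"
    unfolding uminus_l2_def
    by transfer (auto simp: l2_rel_def square_integrable_zero)
  show "x - y = x + - y" by (simp add: minus_l2_def)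
  show C1: "a *\<^sub>C (x + y) = a *\<^sub>C x + a *\<^sub>C y" for a
    by transfer (auto simp: l2_rel_def algebra_simps intro!: square_integrable_add square_integrable_scale)
  show C2: "(a + b) *\<^sub>C x = a *\<^sub>C x + b *\<^sub>C x" for a b
    by transfer (auto simp: l2_rel_def algebra_simps intro!: square_integrable_add square_integrable_scale)
  show C3: "a *\<^sub>C b *\<^sub>C x = (a * b) *\<^sub>C x" for a b
    by transfer (auto simp: l2_rel_def algebra_simps dest: square_integrable_scale)
  have C4: "1 *\<^sub>C x = x"
    by transfer (auto simp: l2_rel_def)
  show "of_real r *\<^sub>C x = r *\<^sub>R x" by (simp add: scaleR_l2_def)
  show "r *\<^sub>R (x + y) = r *\<^sub>R x + r *\<^sub>R y" by (simp add: scaleR_l2_def C1)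
  show "(r + s) *\<^sub>R x = r *\<^sub>R x + s *\<^sub>R x" by (simp add: scaleR_l2_def C2)
  show "r *\<^sub>R s *\<^sub>R x = (r * s) *\<^sub>R x" by (simp add: scaleR_l2_def C3)
  show "1 *\<^sub>R x = x" by (simp add: scaleR_l2_def C4)
  show comm: "cinner x y = cnj (cinner y x)"
  proof transfer
    fix f g assume "l2_rel f f" "l2_rel g g"
    have "cnj (LINT x|Omega_measure. g x * cnj (f x)) = (LINT x|Omega_measure. cnj (g x * cnj (f x)))"
      by (rule Bochner_Integration.integral_cnj[symmetric])
    then show "(LINT x|Omega_measure. f x * cnj (g x)) = cnj (LINT x|Omega_measure. g x * cnj (f x))"
      by (simp add: mult.commute)
  qed
  show add: "cinner (x + y) z = cinner x z + cinner y z"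
  proof transfer
    fix f g h assume "l2_rel f f" "l2_rel g g" "l2_rel h h"
    then show "(LINT x|Omega_measure. (f x + g x) * cnj (h x)) =
        (LINT x|Omega_measure. f x * cnj (h x)) + (LINT x|Omega_measure. g x * cnj (h x))"
      by (simp add: distrib_right Bochner_Integration.integral_add square_integrable_mult
          square_integrable_cnj l2_rel_def)
  qed
  show scale: "cinner (a *\<^sub>C x) y = a * cinner x y" for a
    by transfer (simp add: mult.assoc)
  show "inner x y = Re (cinner x y)" by (simp add: inner_l2_def)
  show "inner x y = inner y x" unfolding inner_l2_def using comm by simp
  show "inner (x + y) z = inner x z + inner y z" by (simp add: inner_l2_def add)
  show "inner (r *\<^sub>R x) y = r * inner x y" by (simp add: inner_l2_def scaleR_l2_def scale)
  have sq: "Re (LINT x|Omega_measure. f x * cnj (f x)) = (LINT x|Omega_measure. (norm (f x))\<^sup>2)" 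
    for f :: "real \<Rightarrow> complex"
    unfolding complex_norm_square[symmetric] by (simp only: integral_complex_of_real Re_complex_of_real)
  show "0 \<le> inner x x" unfolding inner_l2_def
    by transfer (simp only: sq, simp)
  show "inner x x = 0 \<longleftrightarrow> x = 0" unfolding inner_l2_def
  proof transfer
    fix f assume "l2_rel f f"
    then have f: "square_integrable f" by (simp add: l2_rel_def)
    have "(LINT x|Omega_measure. (norm (f x))\<^sup>2) = 0 \<longleftrightarrow> (AE x in Omega_measure. (norm (f x))\<^sup>2 = 0)"
      using f by (intro integral_nonneg_eq_0_iff_AE) (auto simp: square_integrable_def)
    then show "Re (LINT x|Omega_measure. f x * cnj (f x)) = 0 \<longleftrightarrow> l2_rel f (\<lambda>_. 0)"
      using f by (simp only: sq) (simp add: l2_rel_def square_integrable_zero)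
  qed
  show "norm x = sqrt (inner x x)" by (simp add: norm_l2_def)
  show "sgn x = inverse (norm x) *\<^sub>R x" by (simp add: sgn_l2_def)
  show "dist x y = norm (x - y)" by (simp add: dist_l2_def)
  show "(uniformity :: (l2 \<times> l2) filter) = (INF e\<in>{0<..}. principal {(x, y). dist x y < e})"
    by (simp add: uniformity_l2_def)
  show "open U \<longleftrightarrow> (\<forall>x\<in>U. eventually (\<lambda>(x', y). x' = x \<longrightarrow> y \<in> U) uniformity)" for U :: "l2 set"
    by (simp add: open_l2_def)
qed

end



section \<open>Test functions\<close>

definition vderiv :: "(real \<Rightarrow> complex) \<Rightarrow> real \<Rightarrow> complex" where
  "vderiv f = (\<lambda>x. vector_derivative f (at x))"

definition smooth :: "(real \<Rightarrow> complex) \<Rightarrow> bool" where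
  "smooth f \<longleftrightarrow> (\<forall>k x. (vderiv ^^ k) f differentiable at x)"

definition test_function :: "(real \<Rightarrow> complex) \<Rightarrow> bool" where
  "test_function \<phi> \<longleftrightarrow> smooth \<phi> \<and> closure {x. \<phi> x \<noteq> 0} \<subseteq> Omega"

lemma smooth_vderiv: "smooth f \<Longrightarrow> smooth (vderiv f)"
  unfolding smooth_def by (metis funpow_Suc_right o_apply)

lemma smooth_has_vderiv: "smooth f \<Longrightarrow> (f has_vector_derivative vderiv f x) (at x)"
  unfolding smooth_def vderiv_def by (metis funpow_0 vector_derivative_works)

lemma vderiv_eq: "(\<And>x. (f has_vector_derivative f' x) (at x)) \<Longrightarrow> vderiv f = f'"
  by (auto simp: vderiv_def vector_derivative_at)

lemma smooth_coinduct:
  assumes "Q f"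
    and step: "\<And>f. Q f \<Longrightarrow> \<exists>f'. Q f' \<and> (\<forall>x. (f has_vector_derivative f' x) (at x))"
  shows "smooth f"
proof -
  have "Q ((vderiv ^^ k) f)" for k
  proof (induction k)
    case (Suc k)
    then show ?case using step[OF Suc] vderiv_eq by auto
  qed (simp add: assms(1))
  then show ?thesis
    unfolding smooth_def using step by (meson vector_derivative_works differentiableI_vector)
qed

lemma smooth_zero: "smooth (\<lambda>_. 0)"
  by (rule smooth_coinduct[where Q="\<lambda>f. f = (\<lambda>_. 0)"]) auto

lemma smooth_add: 
  assumes "smooth f" "smooth g" shows "smooth (\<lambda>x. f x + g x)"
proof (rule smooth_coinduct[where Q="\<lambda>h. \<exists>f g. smooth f \<and> smooth g \<and> h = (\<lambda>x. f x + g x)"])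
  show "\<exists>f' g'. smooth f' \<and> smooth g' \<and> (\<lambda>x. f x + g x) = (\<lambda>x. f' x + g' x)"
    using assms by blast
  fix h assume "\<exists>f g. smooth f \<and> smooth g \<and> h = (\<lambda>x. f x + g x)"
  then obtain f g where fg: "smooth f" "smooth g" and h: "h = (\<lambda>x. f x + g x)" by blast
  have "(h has_vector_derivative vderiv f x + vderiv g x) (at x)" for x
    unfolding h using smooth_has_vderiv fg by (intro has_vector_derivative_add)
  then show "\<exists>h'. (\<exists>f g. smooth f \<and> smooth g \<and> h' = (\<lambda>x. f x + g x)) \<and>
      (\<forall>x. (h has_vector_derivative h' x) (at x))"
    using fg by (intro exI[of _ "\<lambda>x. vderiv f x + vderiv g x"]) (auto intro!: smooth_vderiv)
qed

lemma smooth_affine: 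
  assumes "smooth f" shows "smooth (\<lambda>x. c * f (r * x + s))"
proof (rule smooth_coinduct[where Q="\<lambda>h. \<exists>f c. smooth f \<and> h = (\<lambda>x. c * f (r * x + s))"])
  show "\<exists>f' c'. smooth f' \<and> (\<lambda>x. c * f (r * x + s)) = (\<lambda>x. c' * f' (r * x + s))"
    using assms by blast
  fix h assume "\<exists>f c. smooth f \<and> h = (\<lambda>x. c * f (r * x + s))"
  then obtain f c where f: "smooth f" and h: "h = (\<lambda>x. c * f (r * x + s))" by blast
  have "(h has_vector_derivative (c * of_real r) * vderiv f (r * x + s)) (at x)" for x
  proof -
    have "((\<lambda>x. r * x + s) has_vector_derivative r) (at x)"
      by (auto intro!: derivative_eq_intros)
    then have "((f \<circ> (\<lambda>x. r * x + s)) has_vector_derivative r *\<^sub>R vderiv f (r * x + s)) (at x)"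
      using smooth_has_vderiv[OF f] by (rule vector_diff_chain_at)
    from has_vector_derivative_mult_right[OF this, of c] show ?thesis
      by (simp add: h o_def scaleR_conv_of_real mult.assoc)
  qed
  then show "\<exists>h'. (\<exists>f c. smooth f \<and> h' = (\<lambda>x. c * f (r * x + s))) \<and>
      (\<forall>x. (h has_vector_derivative h' x) (at x))"
    using f by (intro exI[of _ "\<lambda>x. (c * of_real r) * vderiv f (r * x + s)"]) (blast intro: smooth_vderiv)
qed

lemma smooth_scale: "smooth f \<Longrightarrow> smooth (\<lambda>x. c * f x)"
  using smooth_affine[of f c 1 0] by simp

inductive product_sum :: "(real \<Rightarrow> complex) \<Rightarrow> bool" where
  prod: "smooth f \<Longrightarrow> smooth g \<Longrightarrow> product_sum (\<lambda>x. f x * g x)"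
| add: "product_sum f \<Longrightarrow> product_sum g \<Longrightarrow> product_sum (\<lambda>x. f x + g x)"

lemma smooth_mult:
  assumes "smooth f" "smooth g" shows "smooth (\<lambda>x. f x * g x)"
proof (rule smooth_coinduct[where Q=product_sum])
  show "product_sum (\<lambda>x. f x * g x)" using assms by (rule product_sum.prod)
  fix h assume "product_sum h"
  then show "\<exists>h'. product_sum h' \<and> (\<forall>x. (h has_vector_derivative h' x) (at x))"
  proof induction
    case (prod f g)
    have "((\<lambda>x. f x * g x) has_vector_derivative f x * vderiv g x + vderiv f x * g x) (at x)" for x
      using prod by (intro has_vector_derivative_mult smooth_has_vderiv)
    then show ?case
      using prod by (intro exI[of _ "\<lambda>x. f x * vderiv g x + vderiv f x * g x"])
        (auto intro!: product_sum.intros smooth_vderiv)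
  next
    case (add f g)
    then obtain f' g' where "product_sum f'" "\<And>x. (f has_vector_derivative f' x) (at x)"
      "product_sum g'" "\<And>x. (g has_vector_derivative g' x) (at x)" by blast
    then show ?case
      by (intro exI[of _ "\<lambda>x. f' x + g' x"])
        (auto intro!: product_sum.intros has_vector_derivative_add)
  qed
qed

lemma smooth_continuous: "smooth f \<Longrightarrow> continuous_on S f"
  by (meson continuous_at_imp_continuous_on has_vector_derivative_continuous smooth_has_vderiv)

lemma test_function_vderiv:
  assumes "test_function \<phi>" shows "test_function (vderiv \<phi>)"
proof -
  have "vderiv \<phi> x = 0" if "x \<notin> closure {x. \<phi> x \<noteq> 0}" for x
  proof -
    have "((\<lambda>_. 0) has_vector_derivative 0) (at x)" by simp
    then have "(\<phi> has_vector_derivative 0) (at x)"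
    proof (rule has_vector_derivative_transform_within_open)
      show "open (- closure {x. \<phi> x \<noteq> 0})" "x \<in> - closure {x. \<phi> x \<noteq> 0}" using that by auto
      show "0 = \<phi> y" if "y \<in> - closure {x. \<phi> x \<noteq> 0}" for y
        using that closure_subset[of "{x. \<phi> x \<noteq> 0}"] by auto
    qed
    then show ?thesis by (simp add: vderiv_def vector_derivative_at)
  qed
  then have "closure {x. vderiv \<phi> x \<noteq> 0} \<subseteq> closure {x. \<phi> x \<noteq> 0}"
    by (intro closure_minimal) auto
  then show ?thesis using assms by (auto simp: test_function_def smooth_vderiv)
qed

lemma test_function_nth_vderiv: "test_function \<phi> \<Longrightarrow> test_function ((vderiv ^^ k) \<phi>)"
  by (induction k) (auto intro: test_function_vderiv)

lemma test_function_zero: "test_function (\<lambda>_. 0)"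
  by (simp add: test_function_def smooth_zero)

lemma test_function_add:
  assumes "test_function f" "test_function g" shows "test_function (\<lambda>x. f x + g x)"
proof -
  have "closure {x. f x + g x \<noteq> 0} \<subseteq> closure ({x. f x \<noteq> 0} \<union> {x. g x \<noteq> 0})"
    by (rule closure_mono) auto
  then show ?thesis using assms by (auto simp: test_function_def smooth_add)
qed

lemma test_function_mult:
  assumes "test_function f" "smooth g" shows "test_function (\<lambda>x. g x * f x)"
proof -
  have "closure {x. g x * f x \<noteq> 0} \<subseteq> closure ({x. f x \<noteq> 0})"
    by (rule closure_mono) auto
  then show ?thesis using assms by (auto simp: test_function_def smooth_mult)
qed

lemma smooth_const: "smooth (\<lambda>_. c)"
proof (rule smooth_coinduct[where Q="\<lambda>f. \<exists>c. f = (\<lambda>_. c)"])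
  fix f :: "real \<Rightarrow> complex" assume "\<exists>c. f = (\<lambda>_. c)"
  then show "\<exists>f'. (\<exists>c. f' = (\<lambda>_. c)) \<and> (\<forall>x. (f has_vector_derivative f' x) (at x))"
    by (intro exI[of _ "\<lambda>_. 0"]) auto
qed blast

lemma test_function_scale: "test_function f \<Longrightarrow> test_function (\<lambda>x. c * f x)"
  using test_function_mult[OF _ smooth_const] .

lemma test_function_outside: "test_function \<phi> \<Longrightarrow> x \<notin> Omega \<Longrightarrow> \<phi> x = 0"
  using closure_subset[of "{x. \<phi> x \<noteq> 0}"] by (auto simp: test_function_def)

lemma space_Omega_measure: "space Omega_measure = Omega"
  by (simp add: Omega_measure_def space_restrict_space)

lemma finite_measure_Omega: "finite_measure Omega_measure"
  unfolding Omega_measure_def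
  by (intro finite_measureI) (auto simp: space_restrict_space emeasure_restrict_space Omega_def)

lemma square_integrable_continuous:
  assumes "continuous_on UNIV f" shows "square_integrable f"
proof -
  interpret finite_measure Omega_measure by (rule finite_measure_Omega)
  have m: "f \<in> borel_measurable Omega_measure"
    unfolding Omega_measure_def using assms
    by (intro measurable_restrict_space1) (simp add: borel_measurable_continuous_onI)
  have "compact (f ` {0..1})"
    using assms by (intro compact_continuous_image) (auto intro: continuous_on_subset)
  then obtain B where B: "\<And>x. x \<in> {0..1} \<Longrightarrow> norm (f x) \<le> B"
    using compact_imp_bounded bounded_iff by (metis imageI)
  have "AE x in Omega_measure. norm ((norm (f x))\<^sup>2) \<le> B\<^sup>2"
    by (intro AE_I2) (auto simp: space_Omega_measure Omega_def intro!: power_mono B)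
  then have "integrable Omega_measure (\<lambda>x. (norm (f x))\<^sup>2)"
    using m by (intro integrable_const_bound) auto
  with m show ?thesis by (simp add: square_integrable_def)
qed

lemma square_integrable_smooth: "smooth f \<Longrightarrow> square_integrable f"
  by (intro square_integrable_continuous smooth_continuous)

lemma square_integrable_test: "test_function \<phi> \<Longrightarrow> square_integrable \<phi>"
  by (simp add: test_function_def square_integrable_smooth)

lemma integral_Omega_derivative:
  assumes F: "\<And>x. (F has_vector_derivative f x) (at x)" and f: "continuous_on UNIV f"
    and "F 0 = 0" "F 1 = (0::complex)"
  shows "(LINT x|Omega_measure. f x) = 0"
proof -
  have "(LINT x|Omega_measure. f x) = (LINT x|lborel. indicator Omega x *\<^sub>R f x)"
    unfolding Omega_measure_def by (subst integral_restrict_space) (auto simp: Omega_def)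
  also have "\<dots> = (LINT x|lborel. indicator {0..1} x *\<^sub>R f x)"
  proof (rule integral_cong_AE)
    have [measurable]: "f \<in> borel_measurable borel" by (rule borel_measurable_continuous_onI[OF f])
    show "(\<lambda>x. indicator Omega x *\<^sub>R f x) \<in> borel_measurable lborel"
      unfolding Omega_def by measurable
    show "(\<lambda>x. indicator {0..1} x *\<^sub>R f x) \<in> borel_measurable lborel" by measurable
    have "AE x in lborel. x \<noteq> (0::real)" "AE x in lborel. x \<noteq> (1::real)" by (rule AE_lborel_singleton)+
    then show "AE x in lborel. indicator Omega x *\<^sub>R f x = indicator {0..1} x *\<^sub>R f x"
      by eventually_elim (auto simp: Omega_def indicator_def)
  qed
  also have "\<dots> = F 1 - F 0"
    using F f by (intro integral_FTC_Icc) (auto intro: has_vector_derivative_at_within continuous_on_subset)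
  finally show ?thesis using assms by simp
qed

lemma integration_by_parts_test:
  assumes "test_function \<phi>" "test_function \<psi>"
  shows "(LINT x|Omega_measure. \<phi> x * vderiv \<psi> x) = - (LINT x|Omega_measure. vderiv \<phi> x * \<psi> x)"
proof -
  note s = assms[unfolded test_function_def, THEN conjunct1]
  have "(LINT x|Omega_measure. \<phi> x * vderiv \<psi> x + vderiv \<phi> x * \<psi> x) = 0"
  proof (rule integral_Omega_derivative[where F="\<lambda>x. \<phi> x * \<psi> x"])
    show "((\<lambda>x. \<phi> x * \<psi> x) has_vector_derivative \<phi> x * vderiv \<psi> x + vderiv \<phi> x * \<psi> x) (at x)" for x
      using s by (intro has_vector_derivative_mult smooth_has_vderiv)
    show "continuous_on UNIV (\<lambda>x. \<phi> x * vderiv \<psi> x + vderiv \<phi> x * \<psi> x)"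
      using s by (intro continuous_intros smooth_continuous smooth_vderiv)
  qed (use assms test_function_outside[of \<phi>] in \<open>auto simp: Omega_def\<close>)
  moreover have "integrable Omega_measure (\<lambda>x. \<phi> x * vderiv \<psi> x)" "integrable Omega_measure (\<lambda>x. vderiv \<phi> x * \<psi> x)"
    using assms by (auto intro!: square_integrable_mult square_integrable_test test_function_vderiv)
  ultimately show ?thesis by (simp add: eq_neg_iff_add_eq_0)
qed


subsection \<open>A smooth cut-off\<close>

definition cutoff_poly :: "real \<Rightarrow> real poly \<Rightarrow> real \<Rightarrow> complex" where
  "cutoff_poly c p x = of_real (if x > 0 then poly p (1 / x) * exp (- c / x) else 0)"

lemma cutoff_tendsto:
  fixes c :: real and p :: "real poly"
  assumes "c > 0"
  shows "((\<lambda>x. poly p (1 / x) * exp (- c / x)) \<longlongrightarrow> 0) (at_right 0)"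
proof -
  have "((\<lambda>y::real. y ^ k / exp (c * y)) \<longlongrightarrow> 0) at_top" for k
  proof -
    have "((\<lambda>y::real. y ^ k / exp y) \<longlongrightarrow> 0) at_top" by (rule tendsto_power_div_exp_0)
    moreover have "filterlim (\<lambda>y. c * y) at_top at_top"
      using assms by (intro filterlim_tendsto_pos_mult_at_top[OF tendsto_const _ filterlim_ident])
    ultimately have "((\<lambda>y. (c * y) ^ k / exp (c * y)) \<longlongrightarrow> 0) at_top" by (rule filterlim_compose)
    from tendsto_mult_left[OF this, of "1 / c ^ k"] show ?thesis
      using assms by (simp add: power_mult_distrib)
  qed
  then have "((\<lambda>y. \<Sum>i\<le>degree p. coeff p i * (y ^ i / exp (c * y))) \<longlongrightarrow> (\<Sum>i\<le>degree p. coeff p i * 0)) at_top"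
    by (intro tendsto_intros)
  then have "((\<lambda>y. poly p y * exp (- c * y)) \<longlongrightarrow> 0) at_top"
    by (simp add: poly_altdef sum_distrib_right sum_divide_distrib exp_minus divide_inverse mult.assoc)
  from filterlim_compose[OF this filterlim_inverse_at_top_right] show ?thesis
    by (simp add: divide_inverse)
qed

lemma cutoff_poly_deriv:
  assumes c: "c > 0"
  shows "(cutoff_poly c p has_vector_derivative cutoff_poly c ([:0, 0, 1:] * ([:c:] * p - pderiv p)) x) (at x)"
proof -
  define g where "g p x = (if x > 0 then poly p (1 / x) * exp (- c / x) else 0)" for p and x :: real
  let ?q = "[:0, 0, 1:] * ([:c:] * p - pderiv p)"
  consider "x < 0" | "x = 0" | "x > 0" by linarith
  then have "(g p has_real_derivative g ?q x) (at x)"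
  proof cases
    case 1
    have "((\<lambda>_. 0) has_real_derivative g ?q x) (at x)" using 1 by (simp add: g_def)
    then show ?thesis
      by (rule has_field_derivative_transform_within_open[of _ _ _ "{..<0}"]) (use 1 in \<open>auto simp: g_def\<close>)
  next
    case 3
    have "((\<lambda>x. poly p (1 / x) * exp (- c / x)) has_real_derivative g ?q x) (at x)"
      using 3 by (auto intro!: derivative_eq_intros DERIV_chain2[OF poly_DERIV]
          simp: g_def field_simps power2_eq_square)
    then show ?thesis
      by (rule has_field_derivative_transform_within_open[of _ _ _ "{0<..}"]) (use 3 in \<open>auto simp: g_def\<close>)
  next
    case 2
    have r: "((\<lambda>y. (g p y - g p 0) / (y - 0)) \<longlongrightarrow> 0) (at_right 0)"
    proof (rule Lim_transform_eventually)
      show "((\<lambda>x. poly ([:0, 1:] * p) (1 / x) * exp (- c / x)) \<longlongrightarrow> 0) (at_right 0)"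
        using c by (rule cutoff_tendsto)
      show "\<forall>\<^sub>F x in at_right 0. poly ([:0, 1:] * p) (1 / x) * exp (- c / x) = (g p x - g p 0) / (x - 0)"
        by (auto simp: eventually_at_filter g_def)
    qed
    have l: "((\<lambda>y. (g p y - g p 0) / (y - 0)) \<longlongrightarrow> 0) (at_left 0)"
      by (rule Lim_transform_eventually[OF tendsto_const]) (auto simp: eventually_at_filter g_def)
    show ?thesis using filterlim_split_at[OF l r] 2
      by (simp add: has_field_derivative_iff g_def)
  qed
  then have "(g p has_vector_derivative g ?q x) (at x)"
    by (simp add: has_real_derivative_iff_has_vector_derivative)
  then have "((\<lambda>x. complex_of_real (g p x)) has_vector_derivative of_real (g ?q x)) (at x)"
    by (rule bounded_linear.has_vector_derivative[OF bounded_linear_of_real])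
  then show ?thesis by (simp add: cutoff_poly_def[abs_def] g_def)
qed

definition cutoff :: "real \<Rightarrow> real \<Rightarrow> complex" where
  "cutoff c x = of_real (if x > 0 then exp (- c / x) else 0)"

lemma smooth_cutoff: assumes "c > 0" shows "smooth (cutoff c)"
proof (rule smooth_coinduct[where Q="\<lambda>f. \<exists>p. f = cutoff_poly c p"])
  show "\<exists>p. cutoff c = cutoff_poly c p"
    by (rule exI[of _ 1]) (simp add: fun_eq_iff cutoff_def cutoff_poly_def)
qed (use cutoff_poly_deriv[OF assms] in blast)

definition bump :: "real \<Rightarrow> real \<Rightarrow> real \<Rightarrow> real \<Rightarrow> complex" where
  "bump a b c x = cutoff c (x - a - c) * cutoff c (b - c - x)"

lemma test_function_bump:
  assumes "c > 0" "0 \<le> a" "b \<le> 1" shows "test_function (bump a b c)"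
proof -
  have "smooth (\<lambda>x. cutoff c (x - a - c))" "smooth (\<lambda>x. cutoff c (b - c - x))"
    using smooth_affine[OF smooth_cutoff[OF assms(1)], of 1 1 "-a-c"]
      smooth_affine[OF smooth_cutoff[OF assms(1)], of 1 "-1" "b-c"] by (simp_all add: algebra_simps)
  then have "smooth (bump a b c)" unfolding bump_def[abs_def] by (rule smooth_mult)
  moreover have "closure {x. bump a b c x \<noteq> 0} \<subseteq> {a + c .. b - c}"
    by (rule closure_minimal) (auto simp: bump_def cutoff_def split: if_splits)
  moreover have "{a + c .. b - c} \<subseteq> Omega" using assms by (auto simp: Omega_def)
  ultimately show ?thesis unfolding test_function_def by blast
qed

lemma bump_bound: "c > 0 \<Longrightarrow> norm (bump a b c x) \<le> 1"
  by (auto simp: bump_def cutoff_def norm_mult intro!: mult_le_one)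

lemma cutoff_limit:
  "(\<lambda>n. cutoff (1 / real (Suc n)) (y - 1 / real (Suc n))) \<longlonglongrightarrow> indicator {0<..} y"
proof (cases "y > 0")
  case True
  have 0: "(\<lambda>n. 1 / real (Suc n)) \<longlonglongrightarrow> 0" by (rule LIMSEQ_Suc[OF lim_1_over_n])
  have "(\<lambda>n. complex_of_real (exp (- (1 / real (Suc n)) / (y - 1 / real (Suc n))))) \<longlonglongrightarrow> of_real (exp (- 0 / (y - 0)))"
    using True by (intro tendsto_intros 0) auto
  moreover have "\<forall>\<^sub>F n in sequentially. 1 / real (Suc n) < y"
    using order_tendstoD(2)[OF 0 True] .
  then have "\<forall>\<^sub>F n in sequentially. complex_of_real (exp (- (1 / real (Suc n)) / (y - 1 / real (Suc n))))
      = cutoff (1 / real (Suc n)) (y - 1 / real (Suc n))"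
    by eventually_elim (simp only: cutoff_def, simp)
  ultimately have "(\<lambda>n. cutoff (1 / real (Suc n)) (y - 1 / real (Suc n))) \<longlonglongrightarrow> of_real (exp (- 0 / (y - 0)))"
    by (rule Lim_transform_eventually)
  then show ?thesis using True by (simp only: diff_zero minus_zero div_0 exp_zero of_real_1 indicator_simps greaterThan_iff)
next
  case False
  have eq: "(\<lambda>n. cutoff (1 / real (Suc n)) (y - 1 / real (Suc n))) = (\<lambda>_. 0)"
  proof
    fix n
    have "1 / real (Suc n) > 0" by simp
    then have "\<not> y - 1 / real (Suc n) > 0" using False by linarith
    then show "cutoff (1 / real (Suc n)) (y - 1 / real (Suc n)) = 0"
      by (simp only: cutoff_def if_False of_real_0)
  qed
  show ?thesis unfolding eq using False by simp
qed

lemma bump_limit: "(\<lambda>n. bump a b (1 / real (Suc n)) x) \<longlonglongrightarrow> indicator {a<..<b} x"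
proof -
  have "(\<lambda>n. bump a b (1 / real (Suc n)) x) \<longlonglongrightarrow> indicator {0<..} (x - a) * indicator {0<..} (b - x)"
    using tendsto_mult[OF cutoff_limit[of "x - a"] cutoff_limit[of "b - x"]]
    by (simp add: bump_def algebra_simps)
  moreover have "indicator {0<..} (x - a) * indicator {0<..} (b - x) = (indicator {a<..<b} x :: complex)"
    by (auto simp: indicator_def)
  ultimately show ?thesis by simp
qed

lemma fundamental_lemma_fun:
  assumes f: "square_integrable f"
    and test: "\<And>\<phi>. test_function \<phi> \<Longrightarrow> (LINT x|Omega_measure. f x * \<phi> x) = 0"
  shows "AE x in Omega_measure. f x = 0"
proof -
  interpret finite_measure Omega_measure by (rule finite_measure_Omega)
  show ?thesis
proof (rule density_zero)
  show int: "integrable Omega_measure f"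
    using square_integrable_mult[OF f square_integrable_continuous[of "\<lambda>_. 1"]] by simp
  have sets_Om: "A \<in> sets Omega_measure \<longleftrightarrow> A \<in> sets borel \<and> A \<subseteq> Omega" for A
    unfolding Omega_measure_def by (subst sets_restrict_space_iff) (auto simp: Omega_def)
  have ivl: "set_lebesgue_integral Omega_measure ({a<..<b} \<inter> Omega) f = 0" for a b
  proof -
    define a' b' where "a' = max a 0" and "b' = min b 1"
    have eq: "{a<..<b} \<inter> Omega = {a'<..<b'}" by (auto simp: a'_def b'_def Omega_def)
    have s: "{a'<..<b'} \<in> sets Omega_measure" by (auto simp: sets_Om eq[symmetric] Omega_def)
    have m: "f \<in> borel_measurable Omega_measure" using f by (rule square_integrable_measurable)
    have "(\<lambda>n. LINT x|Omega_measure. f x * bump a' b' (1 / real (Suc n)) x)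
       \<longlonglongrightarrow> (LINT x|Omega_measure. f x * indicator {a'<..<b'} x)"
    proof (rule integral_dominated_convergence[where w="\<lambda>x. norm (f x)"])
      show "(\<lambda>x. f x * indicator {a'<..<b'} x) \<in> borel_measurable Omega_measure"
        using m s by measurable
      show "(\<lambda>x. f x * bump a' b' (1 / real (Suc n)) x) \<in> borel_measurable Omega_measure" for n
        using m square_integrable_measurable[OF square_integrable_test[OF test_function_bump[of "1 / real (Suc n)" a' b']]]
        by (intro borel_measurable_times) (auto simp: a'_def b'_def)
      show "integrable Omega_measure (\<lambda>x. norm (f x))" using int by simp
      show "AE x in Omega_measure. (\<lambda>n. f x * bump a' b' (1 / real (Suc n)) x) \<longlonglongrightarrow> f x * indicator {a'<..<b'} x"
        by (intro AE_I2 tendsto_mult tendsto_const bump_limit)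
      have "norm (f x * bump a' b' (1 / real (Suc n)) x) \<le> norm (f x)" for n x
        using mult_left_mono[OF bump_bound[of "1 / real (Suc n)" a' b' x], of "norm (f x)"]
        by (simp add: norm_mult)
      then show "AE x in Omega_measure. norm (f x * bump a' b' (1 / real (Suc n)) x) \<le> norm (f x)" for n
        by simp
    qed
    moreover have "(LINT x|Omega_measure. f x * bump a' b' (1 / real (Suc n)) x) = 0" for n
      by (rule test, rule test_function_bump) (auto simp: a'_def b'_def)
    ultimately have "(LINT x|Omega_measure. f x * indicator {a'<..<b'} x) = 0"
      using LIMSEQ_unique[OF _ tendsto_const] by simp
    moreover have "(\<lambda>x. indicator {a'<..<b'} x *\<^sub>R f x) = (\<lambda>x. f x * indicator {a'<..<b'} x)"
      by (auto simp: indicator_def)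
    ultimately show ?thesis
      unfolding set_lebesgue_integral_def eq by simp
  qed
  have all: "set_lebesgue_integral Omega_measure Omega f = 0"
    using ivl[of 0 1] by (simp add: Omega_def)
  have sint: "set_integrable Omega_measure A f" if "A \<in> sets Omega_measure" for A
    unfolding set_integrable_def using that int by (rule integrable_mult_indicator)
  fix A assume "A \<in> sets Omega_measure"
  then have A: "A \<in> sigma_sets UNIV (range (\<lambda>(a, b). {a<..<b::real}))" and "A \<subseteq> Omega"
    by (auto simp: sets_Om borel_eq_box box_real)
  have sub: "sigma_sets UNIV (range (\<lambda>(a, b). {a<..<b::real})) = sets borel"
    by (simp add: borel_eq_box box_real)
  have stable: "Int_stable (range (\<lambda>(a, b). {a<..<b::real}))"
    unfolding Int_stable_def
  proof (intro ballI)
    fix A B :: "real set"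
    assume "A \<in> range (\<lambda>(a, b). {a<..<b})" "B \<in> range (\<lambda>(a, b). {a<..<b})"
    then obtain a b c d where AB: "A = {a<..<b}" "B = {c<..<d}" by auto
    have "A \<inter> B = (\<lambda>(a, b). {a<..<b}) (max a c, min b d)" unfolding AB by auto
    then show "A \<inter> B \<in> range (\<lambda>(a, b). {a<..<b})" by blast
  qed
  have generator: "range (\<lambda>(a, b). {a<..<b::real}) \<subseteq> Pow UNIV" by simp
  have "set_lebesgue_integral Omega_measure (A \<inter> Omega) f = 0"
    using stable generator A
  proof (induction rule: sigma_sets_induct_disjoint)
    case (basic A)
    then show ?case using ivl by auto
  next
    case empty
    then show ?case by (simp add: set_lebesgue_integral_def)
  next
    case (compl A)
    let ?A = "A \<inter> Omega" and ?B = "(UNIV - A) \<inter> Omega"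
    have s: "?A \<in> sets Omega_measure" "?B \<in> sets Omega_measure"
      using compl(1) by (auto simp: sets_Om sub Omega_def)
    have "set_lebesgue_integral Omega_measure (?A \<union> ?B) f =
        set_lebesgue_integral Omega_measure ?A f + set_lebesgue_integral Omega_measure ?B f"
      by (intro set_integral_Un sint s) auto
    moreover have "?A \<union> ?B = Omega" by auto
    ultimately show ?case using compl all by simp
  next
    case (union B)
    have s: "B i \<inter> Omega \<in> sets Omega_measure" for i
      using union(2) by (auto simp: sets_Om sub Omega_def)
    have "set_lebesgue_integral Omega_measure (\<Union>i. B i \<inter> Omega) f =
        (\<Sum>i. set_lebesgue_integral Omega_measure (B i \<inter> Omega) f)"
      using union(1) s by (intro lebesgue_integral_countable_add sint sets.countable_UN)
        (auto simp: disjoint_family_on_def)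
    then show ?case using union(3) by simp
  qed
  then show "set_lebesgue_integral Omega_measure A f = 0"
    using \<open>A \<subseteq> Omega\<close> by (simp add: Int_absorb2)
qed
qed



section \<open>Weak derivatives and Sobolev spaces\<close>

lift_definition has_weak_derivative :: "nat \<Rightarrow> l2 \<Rightarrow> l2 \<Rightarrow> bool" is
  "\<lambda>k f g. \<forall>\<phi>. test_function \<phi> \<longrightarrow>
     (LINT x|Omega_measure. f x * (vderiv ^^ k) \<phi> x) = (-1) ^ k * (LINT x|Omega_measure. g x * \<phi> x)"
proof -
  fix k :: nat and f f' g g' :: "real \<Rightarrow> complex"
  assume rel: "l2_rel f f'" "l2_rel g g'"
  have eq: "(LINT x|Omega_measure. f x * \<psi> x) = (LINT x|Omega_measure. f' x * \<psi> x)"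
    if "l2_rel f f'" "test_function \<psi>" for f f' \<psi>
    using that square_integrable_test[OF that(2)]
    by (intro integral_cong_AE) (auto simp: l2_rel_def square_integrable_def)
  show "(\<forall>\<phi>. test_function \<phi> \<longrightarrow>
      (LINT x|Omega_measure. f x * (vderiv ^^ k) \<phi> x) = (-1) ^ k * (LINT x|Omega_measure. g x * \<phi> x)) \<longleftrightarrow>
    (\<forall>\<phi>. test_function \<phi> \<longrightarrow>
      (LINT x|Omega_measure. f' x * (vderiv ^^ k) \<phi> x) = (-1) ^ k * (LINT x|Omega_measure. g' x * \<phi> x))"
    using eq[OF rel(1) test_function_nth_vderiv] eq[OF rel(2)] by simp
qed

text \<open>Weak derivatives are unique (\<open>has_weak_derivative_unique\<close>), so the description below
  denotes the weak derivative whenever it exists.\<close>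

definition weak_derivative :: "nat \<Rightarrow> l2 \<Rightarrow> l2" where
  "weak_derivative k u = (THE v. has_weak_derivative k u v)"

definition sobolev :: "nat \<Rightarrow> l2 set" where
  "sobolev m = {u. \<forall>k\<le>m. \<exists>v. has_weak_derivative k u v}"

definition sobolev_norm :: "nat \<Rightarrow> l2 \<Rightarrow> real" where
  "sobolev_norm m u = sqrt (\<Sum>k\<le>m. (norm (weak_derivative k u))\<^sup>2)"

text \<open>$H_0^1(0,1)$ is the closure of the test functions in $H^1(0,1)$.\<close>

definition H01 :: "l2 set" where
  "H01 = {u \<in> sobolev 1. \<forall>\<epsilon>>0. \<exists>\<phi>. test_function \<phi> \<and> sobolev_norm 1 (u - abs_l2 \<phi>) < \<epsilon>}"

lemma has_weak_derivative_unique: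
  assumes "has_weak_derivative k u v" "has_weak_derivative k u w" shows "v = w"
  using assms
proof transfer
  fix k f g h
  assume rel: "l2_rel f f" "l2_rel g g" "l2_rel h h"
    and g: "\<forall>\<phi>. test_function \<phi> \<longrightarrow>
     (LINT x|Omega_measure. f x * (vderiv ^^ k) \<phi> x) = (-1) ^ k * (LINT x|Omega_measure. g x * \<phi> x)"
    and h: "\<forall>\<phi>. test_function \<phi> \<longrightarrow>
     (LINT x|Omega_measure. f x * (vderiv ^^ k) \<phi> x) = (-1) ^ k * (LINT x|Omega_measure. h x * \<phi> x)"
  have sq: "square_integrable g" "square_integrable h" using rel by (auto simp: l2_rel_def)
  have "AE x in Omega_measure. g x + (-1) * h x = 0"
  proof (rule fundamental_lemma_fun)
    show "square_integrable (\<lambda>x. g x + (-1) * h x)"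
      using sq by (intro square_integrable_add square_integrable_scale)
    fix \<phi> assume \<phi>: "test_function \<phi>"
    have "(-1) ^ k * (LINT x|Omega_measure. g x * \<phi> x) = (-1) ^ k * (LINT x|Omega_measure. h x * \<phi> x)"
      using g h \<phi> by metis
    then have "(LINT x|Omega_measure. g x * \<phi> x) = (LINT x|Omega_measure. h x * \<phi> x)" by simp
    moreover have "integrable Omega_measure (\<lambda>x. g x * \<phi> x)" "integrable Omega_measure (\<lambda>x. h x * \<phi> x)"
      using sq \<phi> by (auto intro: square_integrable_mult square_integrable_test)
    ultimately show "(LINT x|Omega_measure. (g x + (-1) * h x) * \<phi> x) = 0"
      by (simp add: algebra_simps)
  qed
  then show "l2_rel g h" using sq by (auto simp: l2_rel_def)
qed

lemma weak_derivative_eq: "has_weak_derivative k u v \<Longrightarrow> weak_derivative k u = v"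
  unfolding weak_derivative_def using has_weak_derivative_unique by blast

lemma has_weak_derivative_add:
  "has_weak_derivative k u v \<Longrightarrow> has_weak_derivative k u' v' \<Longrightarrow> has_weak_derivative k (u + u') (v + v')"
proof transfer
  fix k f g f' g'
  assume rel: "l2_rel f f" "l2_rel g g" "l2_rel f' f'" "l2_rel g' g'"
    and g: "\<forall>\<phi>. test_function \<phi> \<longrightarrow>
     (LINT x|Omega_measure. f x * (vderiv ^^ k) \<phi> x) = (-1) ^ k * (LINT x|Omega_measure. g x * \<phi> x)"
    and g': "\<forall>\<phi>. test_function \<phi> \<longrightarrow>
     (LINT x|Omega_measure. f' x * (vderiv ^^ k) \<phi> x) = (-1) ^ k * (LINT x|Omega_measure. g' x * \<phi> x)"
  have int: "integrable Omega_measure (\<lambda>x. f x * \<phi> x)" if "l2_rel f f" "test_function \<phi>" for f \<phi>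
    using that by (auto intro!: square_integrable_mult square_integrable_test simp: l2_rel_def)
  show "\<forall>\<phi>. test_function \<phi> \<longrightarrow>
     (LINT x|Omega_measure. (f x + f' x) * (vderiv ^^ k) \<phi> x) =
     (-1) ^ k * (LINT x|Omega_measure. (g x + g' x) * \<phi> x)"
    using g g' by (simp add: distrib_right distrib_left int rel test_function_nth_vderiv)
qed

lemma has_weak_derivative_scaleC:
  "has_weak_derivative k u v \<Longrightarrow> has_weak_derivative k (c *\<^sub>C u) (c *\<^sub>C v)"
  by transfer (simp add: mult.assoc mult.left_commute)

lemma has_weak_derivative_0: "has_weak_derivative 0 u u"
  by transfer simp

lemma weak_derivative_0 [simp]: "weak_derivative 0 u = u"
  by (rule weak_derivative_eq[OF has_weak_derivative_0])

lemma sobolev_weak_derivative: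
  "u \<in> sobolev m \<Longrightarrow> k \<le> m \<Longrightarrow> has_weak_derivative k u (weak_derivative k u)"
  unfolding sobolev_def using weak_derivative_eq by fastforce

lemma sobolev_add: "u \<in> sobolev m \<Longrightarrow> v \<in> sobolev m \<Longrightarrow> u + v \<in> sobolev m"
  unfolding sobolev_def using has_weak_derivative_add by blast

lemma sobolev_scaleC: "u \<in> sobolev m \<Longrightarrow> c *\<^sub>C u \<in> sobolev m"
  unfolding sobolev_def using has_weak_derivative_scaleC by blast

lemma weak_derivative_add:
  "u \<in> sobolev m \<Longrightarrow> v \<in> sobolev m \<Longrightarrow> k \<le> m \<Longrightarrow>
    weak_derivative k (u + v) = weak_derivative k u + weak_derivative k v"
  by (intro weak_derivative_eq has_weak_derivative_add sobolev_weak_derivative)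

lemma weak_derivative_scaleC:
  "u \<in> sobolev m \<Longrightarrow> k \<le> m \<Longrightarrow> weak_derivative k (c *\<^sub>C u) = c *\<^sub>C weak_derivative k u"
  by (intro weak_derivative_eq has_weak_derivative_scaleC sobolev_weak_derivative)

lemma scaleC_one: "1 *\<^sub>C x = (x :: 'a :: complex_inner)"
  using scaleC_of_real[of 1 x] by simp

lemma scaleC_zero_left: "0 *\<^sub>C x = (0 :: 'a :: complex_inner)"
  using scaleC_of_real[of 0 x] by simp

lemma scaleC_minus_one: "(-1) *\<^sub>C x = - (x :: 'a :: complex_inner)"
  using scaleC_of_real[of "-1" x] by simp

lemma sobolev_minus: "u \<in> sobolev m \<Longrightarrow> - u \<in> sobolev m"
  using sobolev_scaleC[of u m "-1"] by (simp add: scaleC_minus_one)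

lemma sobolev_diff: "u \<in> sobolev m \<Longrightarrow> v \<in> sobolev m \<Longrightarrow> u - v \<in> sobolev m"
  using sobolev_add[OF _ sobolev_minus, of u m v] by simp

lemma weak_derivative_diff:
  assumes "u \<in> sobolev m" "v \<in> sobolev m" "k \<le> m"
  shows "weak_derivative k (u - v) = weak_derivative k u - weak_derivative k v"
  using weak_derivative_add[OF assms(1) sobolev_minus[OF assms(2)] assms(3)]
    weak_derivative_scaleC[OF assms(2,3), of "-1"]
  by (simp add: scaleC_minus_one)

lemma l2_rel_refl: "l2_rel f f \<longleftrightarrow> square_integrable f"
  by (simp add: l2_rel_def)

lemma has_weak_derivative_test:
  assumes "test_function \<phi>" shows "has_weak_derivative 1 (abs_l2 \<phi>) (abs_l2 (vderiv \<phi>))"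
proof -
  have "l2_rel \<phi> \<phi>" "l2_rel (vderiv \<phi>) (vderiv \<phi>)"
    using assms by (auto simp: l2_rel_refl intro: square_integrable_test test_function_vderiv)
  then show ?thesis
    using integration_by_parts_test[OF assms] by (simp add: has_weak_derivative.abs_eq)
qed

lemma test_function_sobolev: "test_function \<phi> \<Longrightarrow> abs_l2 \<phi> \<in> sobolev 1"
  unfolding sobolev_def using has_weak_derivative_test has_weak_derivative_0
  by (auto simp: le_Suc_eq)

lemma sobolev_norm_1: "sobolev_norm 1 u = norm (u, weak_derivative 1 u)"
  by (simp add: sobolev_norm_def norm_Pair)

lemma zero_sobolev: "0 \<in> sobolev m" and weak_derivative_zero: "weak_derivative k 0 = 0"
proof -
  have *: "has_weak_derivative k 0 0" for k by transfer simp
  then show "0 \<in> sobolev m" "weak_derivative k 0 = 0"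
    by (auto simp: sobolev_def weak_derivative_eq)
qed

lemma abs_l2_zero: "abs_l2 (\<lambda>_. 0) = 0"
  by (simp add: zero_l2_def)

lemma H01_approx:
  assumes "u \<in> H01" "\<epsilon> > 0"
  obtains \<phi> where "test_function \<phi>" "sobolev_norm 1 (u - abs_l2 \<phi>) < \<epsilon>"
  using assms unfolding H01_def by blast

lemma H01_zero: "0 \<in> H01"
  unfolding H01_def
  by (auto simp: zero_sobolev sobolev_norm_1 weak_derivative_zero norm_Pair abs_l2_zero simp del: One_nat_def
      intro!: exI[of _ "\<lambda>_. 0"] test_function_zero)

lemma H01_add: assumes "u \<in> H01" "v \<in> H01" shows "u + v \<in> H01"
proof -
  have s: "u \<in> sobolev 1" "v \<in> sobolev 1" using assms by (auto simp: H01_def)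
  have "\<exists>\<phi>. test_function \<phi> \<and> sobolev_norm 1 (u + v - abs_l2 \<phi>) < \<epsilon>" if "\<epsilon> > 0" for \<epsilon>
  proof -
    have "\<epsilon> / 2 > 0" using that by simp
    then obtain \<phi> \<psi> where t: "test_function \<phi>" "test_function \<psi>"
      and a: "sobolev_norm 1 (u - abs_l2 \<phi>) < \<epsilon> / 2" "sobolev_norm 1 (v - abs_l2 \<psi>) < \<epsilon> / 2"
      using H01_approx assms by metis
    let ?u = "u - abs_l2 \<phi>" and ?v = "v - abs_l2 \<psi>"
    have "abs_l2 (\<lambda>x. \<phi> x + \<psi> x) = abs_l2 \<phi> + abs_l2 \<psi>"
      using t by (simp add: plus_l2.abs_eq l2_rel_refl square_integrable_test)
    then have eq: "u + v - abs_l2 (\<lambda>x. \<phi> x + \<psi> x) = ?u + ?v" by simp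
    have s': "?u \<in> sobolev 1" "?v \<in> sobolev 1"
      by (intro sobolev_diff test_function_sobolev s t)+
    have "(?u + ?v, weak_derivative 1 (?u + ?v)) = (?u, weak_derivative 1 ?u) + (?v, weak_derivative 1 ?v)"
      using weak_derivative_add[OF s', of 1] by simp
    then have "sobolev_norm 1 (?u + ?v) \<le> sobolev_norm 1 ?u + sobolev_norm 1 ?v"
      unfolding sobolev_norm_1 by (metis norm_triangle_ineq)
    then have "sobolev_norm 1 (u + v - abs_l2 (\<lambda>x. \<phi> x + \<psi> x)) < \<epsilon>" unfolding eq using a by linarith
    then show ?thesis using test_function_add[OF t] by blast
  qed
  then show ?thesis using sobolev_add[OF s] by (auto simp: H01_def)
qed

lemma norm_scaleC: "norm (c *\<^sub>C x) = norm c * norm (x :: 'a :: complex_inner)"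
proof -
  have "cinner (c *\<^sub>C x) (c *\<^sub>C x) = c * cnj c * cinner x x"
    by (metis cinner_commute cinner_scaleC_left complex_cnj_mult mult.assoc complex_cnj_cnj)
  also have "\<dots> = of_real ((norm c)\<^sup>2) * cinner x x" by (simp only: complex_norm_square)
  finally have "inner (c *\<^sub>C x) (c *\<^sub>C x) = (norm c)\<^sup>2 * inner x x"
    by (simp add: inner_eq_Re_cinner)
  then show ?thesis by (simp add: norm_eq_sqrt_inner real_sqrt_mult)
qed

lemma H01_scaleC: assumes "u \<in> H01" shows "c *\<^sub>C u \<in> H01"
proof -
  have s: "u \<in> sobolev 1" using assms by (auto simp: H01_def)
  have "\<exists>\<phi>. test_function \<phi> \<and> sobolev_norm 1 (c *\<^sub>C u - abs_l2 \<phi>) < \<epsilon>" if "\<epsilon> > 0" for \<epsilon>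
  proof -
    have "\<epsilon> / (norm c + 1) > 0" using that by (simp add: add_nonneg_pos)
    with assms obtain \<phi> where t: "test_function \<phi>"
      and a: "sobolev_norm 1 (u - abs_l2 \<phi>) < \<epsilon> / (norm c + 1)"
      by (rule H01_approx)
    let ?u = "u - abs_l2 \<phi>"
    have "abs_l2 (\<lambda>x. c * \<phi> x) = c *\<^sub>C abs_l2 \<phi>"
      using t by (simp add: scaleC_l2.abs_eq l2_rel_refl square_integrable_test)
    moreover have "c *\<^sub>C ?u = c *\<^sub>C u - c *\<^sub>C abs_l2 \<phi>"
      using scaleC_add_right[of c ?u "abs_l2 \<phi>"] by (simp add: algebra_simps)
    ultimately have eq: "c *\<^sub>C u - abs_l2 (\<lambda>x. c * \<phi> x) = c *\<^sub>C ?u" by simp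
    have s': "?u \<in> sobolev 1" by (intro sobolev_diff test_function_sobolev s t)
    have "(c *\<^sub>C ?u, weak_derivative 1 (c *\<^sub>C ?u)) = c *\<^sub>C (?u, weak_derivative 1 ?u)"
      using weak_derivative_scaleC[OF s', of 1] by (simp add: scaleC_prod_def)
    then have "sobolev_norm 1 (c *\<^sub>C ?u) = norm c * sobolev_norm 1 ?u"
      unfolding sobolev_norm_1 by (simp add: norm_scaleC)
    also have "\<dots> \<le> norm c * (\<epsilon> / (norm c + 1))" using a by (intro mult_left_mono) auto
    also have "\<dots> = \<epsilon> * (norm c / (norm c + 1))" by simp
    also have "\<dots> < \<epsilon> * 1"
    proof (intro mult_strict_left_mono)
      show "norm c / (norm c + 1) < 1" by (subst divide_less_eq_1_pos) (auto simp: add_nonneg_pos)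
    qed (rule that)
    also have "\<dots> = \<epsilon>" by simp
    finally show ?thesis unfolding eq[symmetric] using test_function_scale[OF t] by blast
  qed
  then show ?thesis using sobolev_scaleC[OF s] by (auto simp: H01_def)
qed

lemma smooth_ident: "smooth complex_of_real"
  unfolding smooth_def
proof (intro allI)
  have v: "vderiv complex_of_real = (\<lambda>_. 1)"
    using bounded_linear.has_vector_derivative[OF bounded_linear_of_real has_vector_derivative_id]
    by (intro vderiv_eq) simp
  fix k x show "(vderiv ^^ k) complex_of_real differentiable at x"
  proof (cases k)
    case 0
    then show ?thesis
      using bounded_linear_imp_differentiable[OF bounded_linear_of_real] by simp
  next
    case (Suc j)
    then have "(vderiv ^^ k) complex_of_real = (vderiv ^^ j) (\<lambda>_. 1)"
      using v by (simp add: funpow_Suc_right del: funpow.simps)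
    then show ?thesis using smooth_const[of 1] by (simp add: smooth_def)
  qed
qed

lemma Poincare_test:
  assumes t: "test_function \<phi>"
  shows "norm (abs_l2 \<phi>) \<le> 2 * norm (abs_l2 (vderiv \<phi>))"
proof -
  define \<psi> where "\<psi> x = complex_of_real x * \<phi> x" for x
  have s: "smooth \<phi>" using t by (simp add: test_function_def)
  have t\<psi>: "test_function \<psi>" unfolding \<psi>_def[abs_def] by (rule test_function_mult[OF t smooth_ident])
  note sq = square_integrable_test[OF t] square_integrable_test[OF t\<psi>]
    square_integrable_test[OF test_function_vderiv[OF t]]
  let ?F = "\<lambda>x. complex_of_real x * (\<phi> x * cnj (\<phi> x))"
  let ?f = "\<lambda>x. \<phi> x * cnj (\<phi> x) + (vderiv \<phi> x * cnj (\<psi> x) + \<psi> x * cnj (vderiv \<phi> x))"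
  have "(LINT x|Omega_measure. ?f x) = 0"
  proof (rule integral_Omega_derivative[where F="?F"])
    show "(?F has_vector_derivative ?f x) (at x)" for x
    proof -
      have 1: "(complex_of_real has_vector_derivative 1) (at x)"
        using bounded_linear.has_vector_derivative[OF bounded_linear_of_real has_vector_derivative_id] by simp
      have 2: "((\<lambda>x. cnj (\<phi> x)) has_vector_derivative cnj (vderiv \<phi> x)) (at x)"
        by (rule bounded_linear.has_vector_derivative[OF bounded_linear_cnj smooth_has_vderiv[OF s]])
      show ?thesis
        using has_vector_derivative_mult[OF 1 has_vector_derivative_mult[OF smooth_has_vderiv[OF s] 2]]
        by (simp add: \<psi>_def algebra_simps)
    qed
    show "continuous_on UNIV ?f"
      using s t\<psi> by (intro continuous_intros smooth_continuous smooth_vderiv) (auto simp: test_function_def)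
    show "?F 1 = 0" using test_function_outside[OF t, of 1] by (simp add: Omega_def)
  qed simp
  moreover have i: "integrable Omega_measure (\<lambda>x. \<phi> x * cnj (\<phi> x))"
    "integrable Omega_measure (\<lambda>x. vderiv \<phi> x * cnj (\<psi> x))"
    "integrable Omega_measure (\<lambda>x. \<psi> x * cnj (vderiv \<phi> x))"
    using sq by (auto intro!: square_integrable_mult square_integrable_cnj)
  ultimately have "cinner (abs_l2 \<phi>) (abs_l2 \<phi>) + (cinner (abs_l2 (vderiv \<phi>)) (abs_l2 \<psi>) +
      cinner (abs_l2 \<psi>) (abs_l2 (vderiv \<phi>))) = 0"
    using sq by (simp add: cinner_l2.abs_eq l2_rel_refl)
  then have "Re (cinner (abs_l2 \<phi>) (abs_l2 \<phi>) + (cinner (abs_l2 (vderiv \<phi>)) (abs_l2 \<psi>) +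
      cinner (abs_l2 \<psi>) (abs_l2 (vderiv \<phi>)))) = 0" by simp
  then have "inner (abs_l2 \<phi>) (abs_l2 \<phi>) + 2 * inner (abs_l2 (vderiv \<phi>)) (abs_l2 \<psi>) = 0"
    by (simp flip: inner_eq_Re_cinner add: inner_commute)
  then have "(norm (abs_l2 \<phi>))\<^sup>2 \<le> 2 * (norm (abs_l2 (vderiv \<phi>)) * norm (abs_l2 \<psi>))"
    using Cauchy_Schwarz_ineq2[of "abs_l2 (vderiv \<phi>)" "abs_l2 \<psi>"]
    by (simp add: power2_norm_eq_inner)
  also have "norm (abs_l2 \<psi>) \<le> norm (abs_l2 \<phi>)"
  proof -
    have nrm: "(norm (abs_l2 f))\<^sup>2 = (LINT x|Omega_measure. (norm (f x))\<^sup>2)" if "square_integrable f" for f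
    proof -
      have "complex_of_real ((norm (abs_l2 f))\<^sup>2) = complex_of_real (LINT x|Omega_measure. (norm (f x))\<^sup>2)"
      proof -
        have "cinner (abs_l2 f) (abs_l2 f) = (LINT x|Omega_measure. of_real ((norm (f x))\<^sup>2))"
          using that by (simp only: complex_norm_square cinner_l2.abs_eq l2_rel_refl)
        also have "\<dots> = of_real (LINT x|Omega_measure. (norm (f x))\<^sup>2)"
          by (rule integral_complex_of_real)
        finally show ?thesis by (simp add: power2_norm_eq_inner inner_eq_Re_cinner)
      qed
      then show ?thesis by (simp only: of_real_eq_iff)
    qed
    have "(norm (abs_l2 \<psi>))\<^sup>2 \<le> (norm (abs_l2 \<phi>))\<^sup>2"
      unfolding nrm[OF sq(1)] nrm[OF sq(2)]
    proof (rule integral_mono)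
      fix x assume "x \<in> space Omega_measure"
      then have "\<bar>x\<bar> \<le> 1" by (simp add: space_Omega_measure Omega_def)
      then have "norm (\<psi> x) \<le> norm (\<phi> x)"
        using mult_right_mono[of "\<bar>x\<bar>" 1 "norm (\<phi> x)"] by (simp add: \<psi>_def norm_mult)
      then show "(norm (\<psi> x))\<^sup>2 \<le> (norm (\<phi> x))\<^sup>2" by (intro power_mono) auto
    qed (use sq in \<open>auto simp: square_integrable_def\<close>)
    then show ?thesis by (rule power2_le_imp_le) simp
  qed
  finally have "(norm (abs_l2 \<phi>))\<^sup>2 \<le> (2 * norm (abs_l2 (vderiv \<phi>))) * norm (abs_l2 \<phi>)"
    by (simp add: mult_left_mono mult.assoc)
  then show ?thesis
    by (cases "norm (abs_l2 \<phi>) = 0") (simp_all add: power2_eq_square)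
qed

lemma Poincare_H01:
  assumes u: "u \<in> H01" and 0: "weak_derivative 1 u = 0" shows "u = 0"
proof -
  have "norm u \<le> 0 + \<epsilon>" if "\<epsilon> > 0" for \<epsilon>
  proof -
    have "\<epsilon> / 3 > 0" using that by simp
    with u obtain \<phi> where t: "test_function \<phi>" and a: "sobolev_norm 1 (u - abs_l2 \<phi>) < \<epsilon> / 3"
      by (rule H01_approx)
    have s: "u \<in> sobolev 1" using u by (simp add: H01_def)
    have d: "weak_derivative 1 (abs_l2 \<phi>) = abs_l2 (vderiv \<phi>)"
      by (rule weak_derivative_eq[OF has_weak_derivative_test[OF t]])
    have "weak_derivative 1 (u - abs_l2 \<phi>) = - abs_l2 (vderiv \<phi>)"
      using weak_derivative_diff[OF s test_function_sobolev[OF t], of 1] 0 d by simp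
    then have n: "norm (u - abs_l2 \<phi>) < \<epsilon> / 3" "norm (abs_l2 (vderiv \<phi>)) < \<epsilon> / 3"
      using a norm_fst_le[of "u - abs_l2 \<phi>" "- abs_l2 (vderiv \<phi>)"]
        norm_snd_le[of "- abs_l2 (vderiv \<phi>)" "u - abs_l2 \<phi>"]
      unfolding sobolev_norm_1 by simp_all
    have "norm u \<le> norm (u - abs_l2 \<phi>) + norm (abs_l2 \<phi>)"
      using norm_triangle_ineq[of "u - abs_l2 \<phi>" "abs_l2 \<phi>"] by simp
    then show ?thesis using n Poincare_test[OF t] by linarith
  qed
  then have "norm u \<le> 0" by (rule field_le_epsilon)
  then show ?thesis by simp
qed


section \<open>The space $H_0^1(0,1)$\<close>

typedef h01 = H01 morphisms h01_l2 Abs_h01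
  using H01_zero by blast

setup_lifting type_definition_h01

lemma h01_sobolev: "h01_l2 u \<in> sobolev 1"
  using h01_l2[of u] by (simp add: H01_def)

instantiation h01 :: complex_inner
begin

lift_definition zero_h01 :: h01 is 0 by (rule H01_zero)
lift_definition plus_h01 :: "h01 \<Rightarrow> h01 \<Rightarrow> h01" is "(+)" by (rule H01_add)
lift_definition scaleC_h01 :: "complex \<Rightarrow> h01 \<Rightarrow> h01" is "scaleC" by (rule H01_scaleC)

definition scaleR_h01 :: "real \<Rightarrow> h01 \<Rightarrow> h01" where "scaleR_h01 r u = of_real r *\<^sub>C u"
definition uminus_h01 :: "h01 \<Rightarrow> h01" where "uminus_h01 u = (-1) *\<^sub>C u"
definition minus_h01 :: "h01 \<Rightarrow> h01 \<Rightarrow> h01" where "minus_h01 u v = u + - v"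

text \<open>Only the derivatives enter the inner product; definiteness is the Poincare inequality.\<close>

definition cinner_h01 :: "h01 \<Rightarrow> h01 \<Rightarrow> complex" where
  "cinner_h01 u v = cinner (weak_derivative 1 (h01_l2 u)) (weak_derivative 1 (h01_l2 v))"

definition inner_h01 :: "h01 \<Rightarrow> h01 \<Rightarrow> real" where "inner_h01 u v = Re (cinner u v)"
definition norm_h01 :: "h01 \<Rightarrow> real" where "norm_h01 u = sqrt (inner u u)"
definition sgn_h01 :: "h01 \<Rightarrow> h01" where "sgn_h01 u = inverse (norm u) *\<^sub>R u"
definition dist_h01 :: "h01 \<Rightarrow> h01 \<Rightarrow> real" where "dist_h01 u v = norm (u - v)"
definition uniformity_h01 :: "(h01 \<times> h01) filter" where
  "uniformity_h01 = (INF e\<in>{0<..}. principal {(x, y). dist x y < e})"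
definition open_h01 :: "h01 set \<Rightarrow> bool" where
  "open_h01 U \<longleftrightarrow> (\<forall>x\<in>U. eventually (\<lambda>(x', y). x' = x \<longrightarrow> y \<in> U) uniformity)"

instance
proof
  fix a b :: complex and r s :: real and x y z :: h01
  show "x + y + z = x + (y + z)" by transfer (simp add: add.assoc)
  show "x + y = y + x" by transfer (simp add: add.commute)
  show "0 + x = x" by transfer simp
  show "- x + x = 0" unfolding uminus_h01_def by transfer (simp add: scaleC_minus_one)
  show "x - y = x + - y" by (simp add: minus_h01_def)
  show C1: "a *\<^sub>C (x + y) = a *\<^sub>C x + a *\<^sub>C y" for a by transfer (simp add: scaleC_add_right)
  show C2: "(a + b) *\<^sub>C x = a *\<^sub>C x + b *\<^sub>C x" for a b by transfer (simp add: scaleC_add_left)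
  show C3: "a *\<^sub>C b *\<^sub>C x = (a * b) *\<^sub>C x" for a b by transfer (simp add: scaleC_scaleC)
  have C4: "1 *\<^sub>C x = x" by transfer (simp add: scaleC_one)
  show "of_real r *\<^sub>C x = r *\<^sub>R x" by (simp add: scaleR_h01_def)
  show "r *\<^sub>R (x + y) = r *\<^sub>R x + r *\<^sub>R y" by (simp add: scaleR_h01_def C1)
  show "(r + s) *\<^sub>R x = r *\<^sub>R x + s *\<^sub>R x" by (simp add: scaleR_h01_def C2)
  show "r *\<^sub>R s *\<^sub>R x = (r * s) *\<^sub>R x" by (simp add: scaleR_h01_def C3)
  show "1 *\<^sub>R x = x" by (simp add: scaleR_h01_def C4)
  show comm: "cinner x y = cnj (cinner y x)" unfolding cinner_h01_def by (rule cinner_commute)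
  show add: "cinner (x + y) z = cinner x z + cinner y z"
    using weak_derivative_add[OF h01_sobolev h01_sobolev order_refl]
    by (simp add: cinner_h01_def plus_h01.rep_eq cinner_add_left)
  show scale: "cinner (a *\<^sub>C x) y = a * cinner x y" for a
    using weak_derivative_scaleC[OF h01_sobolev order_refl]
    by (simp add: cinner_h01_def scaleC_h01.rep_eq cinner_scaleC_left)
  show "inner x y = Re (cinner x y)" by (simp add: inner_h01_def)
  show "inner x y = inner y x" unfolding inner_h01_def using comm by simp
  show "inner (x + y) z = inner x z + inner y z" by (simp add: inner_h01_def add)
  show "inner (r *\<^sub>R x) y = r * inner x y" by (simp add: inner_h01_def scaleR_h01_def scale)
  have sq: "inner x x = inner (weak_derivative 1 (h01_l2 x)) (weak_derivative 1 (h01_l2 x))"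
    by (simp add: inner_h01_def cinner_h01_def inner_eq_Re_cinner)
  show "0 \<le> inner x x" by (simp add: sq)
  show "inner x x = 0 \<longleftrightarrow> x = 0"
  proof
    assume "inner x x = 0"
    then have "weak_derivative 1 (h01_l2 x) = 0" by (simp add: sq)
    then have "h01_l2 x = h01_l2 0" using Poincare_H01[OF h01_l2] by (simp add: zero_h01.rep_eq)
    then show "x = 0" by (simp only: h01_l2_inject)
  next
    assume "x = 0"
    then show "inner x x = 0" unfolding sq by (simp add: zero_h01.rep_eq weak_derivative_zero)
  qed
  show "norm x = sqrt (inner x x)" by (simp add: norm_h01_def)
  show "sgn x = inverse (norm x) *\<^sub>R x" by (simp add: sgn_h01_def)
  show "dist x y = norm (x - y)" by (simp add: dist_h01_def)
  show "(uniformity :: (h01 \<times> h01) filter) = (INF e\<in>{0<..}. principal {(x, y). dist x y < e})"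
    by (simp add: uniformity_h01_def)
  show "open U \<longleftrightarrow> (\<forall>x\<in>U. eventually (\<lambda>(x', y). x' = x \<longrightarrow> y \<in> U) uniformity)" for U :: "h01 set"
    by (simp add: open_h01_def)
qed

end


section \<open>The wave operator and groups of operators\<close>

text \<open>The energy space $H_0^1 \times L^2$. Its inner product is that of the product instance, that is
  $\int \partial_x u\, \overline{\partial_x \tilde u} + \int v\, \overline{\tilde v}$.\<close>

type_synonym energy_space = "h01 \<times> l2"

definition wave_domain :: "energy_space set" where
  "wave_domain = {(u, v). h01_l2 u \<in> sobolev 2 \<and> v \<in> H01}"

text \<open>The values of \<open>wave_operator\<close> are meaningful only on \<open>wave_domain\<close>.\<close>

definition wave_operator :: "energy_space \<Rightarrow> energy_space" where
  "wave_operator = (\<lambda>(u, v). (Abs_h01 v, weak_derivative 2 (h01_l2 u)))"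

definition bounded_clinear :: "('a::complex_inner \<Rightarrow> 'b::complex_inner) \<Rightarrow> bool" where
  "bounded_clinear f \<longleftrightarrow> bounded_linear f \<and> (\<forall>c x. f (c *\<^sub>C x) = c *\<^sub>C f x)"

definition C0_group :: "(real \<Rightarrow> 'a::complex_inner \<Rightarrow> 'a) \<Rightarrow> bool" where
  "C0_group S \<longleftrightarrow> (\<forall>t. bounded_clinear (S t)) \<and> S 0 = id \<and> (\<forall>s t. S (s + t) = S s \<circ> S t) \<and>
     (\<forall>x. ((\<lambda>t. S t x) \<longlongrightarrow> x) (at 0))"

text \<open>The generator of a group is given by the two-sided limit of the difference quotient, and its domain
  consists of exactly those vectors for which this limit exists.\<close>

definition generates_group ::
    "'a set \<Rightarrow> ('a \<Rightarrow> 'a) \<Rightarrow> (real \<Rightarrow> 'a::complex_inner \<Rightarrow> 'a) \<Rightarrow> bool" where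
  "generates_group D A S \<longleftrightarrow> C0_group S \<and>
     D = {x. \<exists>y. ((\<lambda>h. (S h x - x) /\<^sub>R h) \<longlongrightarrow> y) (at 0)} \<and>
     (\<forall>x\<in>D. ((\<lambda>h. (S h x - x) /\<^sub>R h) \<longlongrightarrow> A x) (at 0))"

definition isometries :: "(real \<Rightarrow> 'a::complex_inner \<Rightarrow> 'a) \<Rightarrow> bool" where
  "isometries S \<longleftrightarrow> (\<forall>t x. norm (S t x) = norm x)"


section \<open>Classical solutions of the impulsive system\<close>

definition piecewise_continuous :: "real \<Rightarrow> real set \<Rightarrow> (real \<Rightarrow> 'a::topological_space) \<Rightarrow> bool" where
  "piecewise_continuous T P y \<longleftrightarrow> continuous_on ({0..T} - P) y \<and>
     (\<forall>p\<in>P. \<exists>l r. (y \<longlongrightarrow> l) (at_left p) \<and> (y \<longlongrightarrow> r) (at_right p) \<and> y p = l)"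

text \<open>The impulse times are \<open>\<tau> 1 < \<dots> < \<tau> n\<close>; only the values of \<open>\<Psi>\<close> on \<open>{0..T}\<close> matter.\<close>

definition classical_solution ::
    "real \<Rightarrow> nat \<Rightarrow> (nat \<Rightarrow> real) \<Rightarrow> (nat \<Rightarrow> h01) \<Rightarrow> energy_space \<Rightarrow> (real \<Rightarrow> energy_space) \<Rightarrow> bool" where
  "classical_solution T n \<tau> \<Upsilon> \<Psi>\<^sub>0 \<Psi> \<longleftrightarrow>
     piecewise_continuous T (\<tau> ` {1..n}) \<Psi> \<and>
     \<Psi> C1_differentiable_on ({0<..<T} - \<tau> ` {1..n}) \<and>
     (\<forall>t \<in> {0<..<T} - \<tau> ` {1..n}. \<Psi> t \<in> wave_domain) \<and>
     (\<forall>t \<in> {0<..<T} - \<tau> ` {1..n}. (\<Psi> has_vector_derivative wave_operator (\<Psi> t)) (at t)) \<and>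
     (\<forall>k \<in> {1..n}. Lim (at_right (\<tau> k)) \<Psi> = Lim (at_left (\<tau> k)) \<Psi> + (0, h01_l2 (\<Upsilon> k))) \<and>
     \<Psi> 0 = \<Psi>\<^sub>0"

end

theory Submission
  imports Defs
begin

text \<open>Existence: by the group law, translates of an orbit through a vector of the domain are
  differentiable, so the formula defines a solution, the term with index \<open>k\<close> being switched on at
  \<open>\<tau> k\<close>. Uniqueness: the jumps cancel in the difference of two solutions, which is therefore
  continuous. Differentiating \<open>norm (S h x) = norm x\<close> at \<open>h = 0\<close> shows that \<open>A x\<close> is orthogonal to
  \<open>x\<close>, so the norm of this difference is constant, hence zero.\<close>

section \<open>Strongly continuous groups and their generators\<close>

lemma C0_group_linear:
  assumes "C0_group S" shows "bounded_linear (S t)"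
  using assms by (simp add: C0_group_def bounded_clinear_def)

lemma C0_group_add:
  assumes "C0_group S" shows "S (s + t) x = S s (S t x)"
  using assms by (simp add: C0_group_def)

lemma C0_group_zero:
  assumes "C0_group S" shows "S 0 x = x"
  using assms by (simp add: C0_group_def)

text \<open>Strong continuity is postulated only at time 0; the group law and the boundedness of
  \<open>S t\<close> carry it to every time.\<close>

lemma C0_group_isCont:
  assumes "C0_group S" shows "isCont (\<lambda>t. S t x) t"
proof -
  have "((\<lambda>h. S h x) \<longlongrightarrow> x) (at 0)" using assms by (simp add: C0_group_def)
  then have "((\<lambda>h. S t (S h x)) \<longlongrightarrow> S t x) (at 0)"
    by (rule bounded_linear.tendsto[OF C0_group_linear[OF assms]])
  then have "((\<lambda>h. S (t + h) x) \<longlongrightarrow> S t x) (at 0)"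
    by (simp only: C0_group_add[OF assms])
  then show ?thesis by (simp add: isCont_iff)
qed

lemma generates_group_C0: "generates_group D A S \<Longrightarrow> C0_group S"
  by (simp add: generates_group_def)

lemma generates_group_tendsto:
  "generates_group D A S \<Longrightarrow> x \<in> D \<Longrightarrow> ((\<lambda>h. (S h x - x) /\<^sub>R h) \<longlongrightarrow> A x) (at 0)"
  by (simp add: generates_group_def)

text \<open>The domain consists of all vectors whose difference quotient converges, so exhibiting a
  limit gives membership and the value of \<open>A\<close> at once. Linearity of \<open>A\<close>,
  which is not assumed, is derived through this rule.\<close>

lemma generates_groupI:
  assumes g: "generates_group D A S" and l: "((\<lambda>h. (S h x - x) /\<^sub>R h) \<longlongrightarrow> y) (at 0)"
  shows "x \<in> D" and "A x = y"
proof -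
  show D: "x \<in> D" using g l by (auto simp: generates_group_def)
  show "A x = y" by (rule tendsto_unique[OF _ generates_group_tendsto[OF g D] l]) simp
qed

lemma generator_zero:
  assumes g: "generates_group D A S"
  shows "0 \<in> D" and "A 0 = 0"
proof -
  have l: "((\<lambda>h. (S h 0 - 0) /\<^sub>R h) \<longlongrightarrow> 0) (at 0)"
    by (simp add: linear_simps[OF C0_group_linear[OF generates_group_C0[OF g]]])
  show "0 \<in> D" and "A 0 = 0" by (rule generates_groupI[OF g l])+
qed

lemma generator_diff:
  assumes g: "generates_group D A S" and "x \<in> D" "y \<in> D"
  shows "x - y \<in> D" and "A (x - y) = A x - A y"
proof -
  have "((\<lambda>h. (S h x - x) /\<^sub>R h - (S h y - y) /\<^sub>R h) \<longlongrightarrow> A x - A y) (at 0)"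
    by (intro tendsto_diff generates_group_tendsto[OF g] assms)
  moreover have "(S h x - x) /\<^sub>R h - (S h y - y) /\<^sub>R h = (S h (x - y) - (x - y)) /\<^sub>R h" for h
    by (simp add: linear_simps[OF C0_group_linear[OF generates_group_C0[OF g]]] algebra_simps)
  ultimately have l: "((\<lambda>h. (S h (x - y) - (x - y)) /\<^sub>R h) \<longlongrightarrow> A x - A y) (at 0)" by simp
  show "x - y \<in> D" and "A (x - y) = A x - A y" by (rule generates_groupI[OF g l])+
qed

lemma generator_add:
  assumes g: "generates_group D A S" and x: "x \<in> D" and y: "y \<in> D"
  shows "x + y \<in> D" and "A (x + y) = A x + A y"
proof -
  \<comment> \<open>The sum is treated as the difference \<open>x - (0 - y)\<close>.\<close>
  note n = generator_diff[OF g generator_zero(1)[OF g] y]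
  show "x + y \<in> D" and "A (x + y) = A x + A y"
    using generator_diff[OF g x n(1)] n(2) generator_zero(2)[OF g] by simp_all
qed

text \<open>Since \<open>S t\<close> commutes with \<open>S h\<close>, applying the bounded map
  \<open>S t\<close> to the difference quotient of \<open>x\<close> gives both the quotient of the
  vector \<open>S t x\<close> and the quotient of the orbit at time \<open>t\<close>. One limit thus
  yields all three claims.\<close>

lemma generator_orbit:
  assumes g: "generates_group D A S" and x: "x \<in> D"
  shows "S t x \<in> D" and "A (S t x) = S t (A x)"
    and "((\<lambda>t. S t x) has_vector_derivative S t (A x)) (at t)"
proof -
  note C = generates_group_C0[OF g]
  have l: "((\<lambda>h. S t ((S h x - x) /\<^sub>R h)) \<longlongrightarrow> S t (A x)) (at 0)"
    by (rule bounded_linear.tendsto[OF C0_group_linear[OF C] generates_group_tendsto[OF g x]])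
  have e: "S t ((S h x - x) /\<^sub>R h) = (S (t + h) x - S t x) /\<^sub>R h" for h
    by (simp add: linear_simps[OF C0_group_linear[OF C]] C0_group_add[OF C])
  have "S t (S h x) = S h (S t x)" for h
    by (metis C0_group_add[OF C] add.commute)
  then have l': "((\<lambda>h. (S h (S t x) - S t x) /\<^sub>R h) \<longlongrightarrow> S t (A x)) (at 0)"
    using l by (simp add: linear_simps[OF C0_group_linear[OF C]])
  show "S t x \<in> D" and "A (S t x) = S t (A x)" by (rule generates_groupI[OF g l'])+
  show "((\<lambda>t. S t x) has_vector_derivative S t (A x)) (at t)"
    unfolding has_vector_derivative_def has_derivative_at
  proof (intro conjI bounded_linear_scaleR_left)
    have "((\<lambda>h. norm ((S (t + h) x - S t x) /\<^sub>R h - S t (A x))) \<longlongrightarrow> 0) (at 0)"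
      using l unfolding e by (rule tendsto_norm_zero[OF LIM_zero])
    \<comment> \<open>At \<open>h = 0\<close> the two sides may differ because division by zero
      yields zero; the filter at 0 ignores that point.\<close>
    moreover have "norm ((S (t + h) x - S t x) /\<^sub>R h - S t (A x)) =
        norm (S (t + h) x - S t x - h *\<^sub>R S t (A x)) / norm h" if "h \<noteq> 0" for h
    proof -
      have "(S (t + h) x - S t x) /\<^sub>R h - S t (A x) =
          (S (t + h) x - S t x - h *\<^sub>R S t (A x)) /\<^sub>R h"
        using that by (simp add: scaleR_diff_right)
      then show ?thesis by (simp add: divide_inverse mult.commute)
    qed
    ultimately show "(\<lambda>h. norm (S (t + h) x - S t x - h *\<^sub>R S t (A x)) / norm h) \<midarrow>0\<rightarrow> 0"
      by (subst (asm) filterlim_cong[OF refl refl]) (auto simp: eventually_at_filter)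
  qed
qed

text \<open>Orthogonality in the real inner product, that is, for the real part of
  \<open>cinner\<close>; this is all that the derivative of the squared norm sees.\<close>

lemma generator_orthogonal:
  assumes g: "generates_group D A S" and i: "isometries S" and x: "x \<in> D"
  shows "inner (A x) x = 0"
proof -
  note C = generates_group_C0[OF g]
  have "((\<lambda>t. S t x) has_vector_derivative A x) (at 0)"
    using generator_orbit(3)[OF g x, of 0] by (simp add: C0_group_zero[OF C])
  then have "((\<lambda>t. inner (S t x) (S t x)) has_derivative
      (\<lambda>h. inner (S 0 x) (h *\<^sub>R A x) + inner (h *\<^sub>R A x) (S 0 x))) (at 0)"
    unfolding has_vector_derivative_def by (intro has_derivative_inner)
  moreover have "inner (S t x) (S t x) = inner x x" for t
    using i by (simp add: isometries_def power2_norm_eq_inner[symmetric])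
  ultimately have "((\<lambda>t::real. inner x x) has_derivative
      (\<lambda>h. inner (S 0 x) (h *\<^sub>R A x) + inner (h *\<^sub>R A x) (S 0 x))) (at 0)" by simp
  then have "(\<lambda>h. inner (S 0 x) (h *\<^sub>R A x) + inner (h *\<^sub>R A x) (S 0 x)) = (\<lambda>h. 0)"
    by (rule has_derivative_unique) (rule has_derivative_const)
  from fun_cong[OF this, of 1] show ?thesis by (simp add: C0_group_zero[OF C] inner_commute)
qed

section \<open>Orbits switched on at an impulse time\<close>

text \<open>The strict inequality assigns the value 0 at time \<open>p\<close> itself. This makes
  the function left continuous, as the solution space demands, with a jump of height
  \<open>S 0 b = b\<close>.\<close>

definition delayed_orbit ::
    "(real \<Rightarrow> 'a::complex_inner \<Rightarrow> 'a) \<Rightarrow> real \<Rightarrow> 'a \<Rightarrow> real \<Rightarrow> 'a" where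
  "delayed_orbit S p b t = (if p < t then S (t - p) b else 0)"

text \<open>Away from \<open>p\<close> the test \<open>p < s\<close> is locally constant in
  \<open>s\<close> and can be frozen at \<open>t\<close>, which reduces local questions to a shifted
  orbit or to zero.\<close>

lemma eventually_delayed_orbit:
  assumes "t \<noteq> p"
  shows "eventually (\<lambda>s. delayed_orbit S p b s = (if p < t then S (s - p) b else 0)) (nhds t)"
proof (cases "p < t")
  case True
  then have "eventually (\<lambda>s. s \<in> {p<..}) (nhds t)" by (intro eventually_nhds_in_open) auto
  then show ?thesis by eventually_elim (use True in \<open>simp add: delayed_orbit_def\<close>)
next
  case False
  with assms have "eventually (\<lambda>s. s \<in> {..<p}) (nhds t)" by (intro eventually_nhds_in_open) auto
  then show ?thesis by eventually_elim (use False in \<open>simp add: delayed_orbit_def\<close>)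
qed

lemma isCont_shifted_orbit:
  assumes "C0_group S" shows "isCont (\<lambda>s. S (s - p) b) t"
  by (rule isCont_o2[where g="\<lambda>s. S s b", OF _ C0_group_isCont[OF assms]]) simp

lemma isCont_delayed_orbit:
  assumes "C0_group S" and "t \<noteq> p" shows "isCont (delayed_orbit S p b) t"
proof -
  have "isCont (\<lambda>s. if p < t then S (s - p) b else 0) t"
    by (cases "p < t") (simp_all add: isCont_shifted_orbit[OF assms(1)])
  then show ?thesis by (subst isCont_cong[OF eventually_delayed_orbit[OF assms(2)]])
qed

lemma delayed_orbit_at_left:
  assumes "C0_group S" shows "(delayed_orbit S p b \<longlongrightarrow> delayed_orbit S p b t) (at_left t)"
proof (cases "t = p")
  case True
  have "eventually (\<lambda>s. delayed_orbit S p b s = 0) (at_left p)"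
    by (auto simp: eventually_at_filter delayed_orbit_def)
  then show ?thesis using True by (auto simp: delayed_orbit_def intro: tendsto_eventually)
next
  case False
  from isCont_delayed_orbit[OF assms this] show ?thesis
    unfolding isCont_def by (rule tendsto_within_subset) simp
qed
text \<open>The jump is written as a conditional correction so that a sum of delayed orbits, not all
  of which jump at \<open>t\<close>, can be handled term by term.\<close>

lemma delayed_orbit_at_right:
  assumes C: "C0_group S"
  shows "(delayed_orbit S p b \<longlongrightarrow> delayed_orbit S p b t + (if p = t then b else 0)) (at_right t)"
proof (cases "p = t")
  case True
  have "((\<lambda>s. S (s - p) b) \<longlongrightarrow> S (p - p) b) (at_right p)"
    using isCont_shifted_orbit[OF C] unfolding isCont_def by (rule tendsto_within_subset) simp
  then have "((\<lambda>s. S (s - p) b) \<longlongrightarrow> b) (at_right p)" by (simp add: C0_group_zero[OF C])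
  moreover have "eventually (\<lambda>s. S (s - p) b = delayed_orbit S p b s) (at_right p)"
    by (auto simp: eventually_at_filter delayed_orbit_def)
  ultimately have "(delayed_orbit S p b \<longlongrightarrow> b) (at_right p)" by (rule Lim_transform_eventually)
  then show ?thesis using True by (simp add: delayed_orbit_def)
next
  case False
  then have "isCont (delayed_orbit S p b) t" by (intro isCont_delayed_orbit[OF C]) simp
  then show ?thesis using False unfolding isCont_def by (auto intro: tendsto_within_subset)
qed

text \<open>Up to time \<open>p\<close> this is the statement about the zero vector, afterwards the
  invariance of the domain under the group.\<close>

lemma delayed_orbit_in_domain:
  assumes g: "generates_group D A S" and b: "b \<in> D"
  shows "delayed_orbit S p b t \<in> D" and "A (delayed_orbit S p b t) = delayed_orbit S p (A b) t"
  using generator_zero[OF g] generator_orbit[OF g b] by (simp_all add: delayed_orbit_def)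

lemma delayed_orbit_has_vector_derivative:
  assumes g: "generates_group D A S" and b: "b \<in> D" and t: "t \<noteq> p"
  shows "(delayed_orbit S p b has_vector_derivative delayed_orbit S p (A b) t) (at t)"
proof -
  have "((\<lambda>s. S (s - p) b) has_vector_derivative 1 *\<^sub>R S (t - p) (A b)) (at t)"
    by (rule vector_diff_chain_at[where f="\<lambda>s. s - p" and g="\<lambda>s. S s b", unfolded o_def])
      (auto intro!: derivative_eq_intros generator_orbit(3)[OF g b])
  then have "((\<lambda>s. if p < t then S (s - p) b else 0) has_vector_derivative
      delayed_orbit S p (A b) t) (at t)"
    by (simp add: delayed_orbit_def)
  \<comment> \<open>Transferring the derivative requires equality on a punctured neighbourhood and
    at \<open>t\<close> itself; \<open>e\<close> supplies both.\<close>
  moreover have e: "eventually (\<lambda>s. (if p < t then S (s - p) b else 0) = delayed_orbit S p b s) (nhds t)"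
    using eventually_delayed_orbit[OF t, of S b] by eventually_elim simp
  moreover have "eventually (\<lambda>s. (if p < t then S (s - p) b else 0) = delayed_orbit S p b s) (at t)"
    using e by (simp add: eventually_at_filter eventually_mono)
  ultimately show ?thesis
    unfolding has_vector_derivative_def
    using eventually_nhds_x_imp_x[OF e] by (blast intro: has_derivative_transform_eventually)
qed

lemma generator_sum:
  assumes g: "generates_group D A S" and f: "\<And>k. k \<in> I \<Longrightarrow> f k \<in> D"
  shows "(\<Sum>k\<in>I. f k) \<in> D" and "A (\<Sum>k\<in>I. f k) = (\<Sum>k\<in>I. A (f k))"
proof -
  have "(\<Sum>k\<in>I. f k) \<in> D \<and> A (\<Sum>k\<in>I. f k) = (\<Sum>k\<in>I. A (f k))"
    using f by (induction I rule: infinite_finite_induct)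
      (auto simp: generator_zero[OF g] generator_add[OF g])
  then show "(\<Sum>k\<in>I. f k) \<in> D" and "A (\<Sum>k\<in>I. f k) = (\<Sum>k\<in>I. A (f k))" by auto
qed

text \<open>Here the assumption that the impulses lie in \<open>H01\<close> enters: they belong to
  the domain of the generator, so the solution stays in it after each jump.\<close>

lemma wave_domain_velocity: "(0, h01_l2 v) \<in> wave_domain"
  by (simp add: wave_domain_def zero_h01.rep_eq h01_l2 zero_sobolev)

section \<open>Jumps and uniqueness of classical solutions\<close>

text \<open>The jump condition is phrased with the description \<open>Lim\<close>; piecewise
  continuity supplies the existence of the limits, which turns it into genuine convergence.\<close>

lemma classical_solution_one_sided_limits:
  assumes s: "classical_solution T n \<tau> \<Upsilon> \<Psi>\<^sub>0 \<Psi>" and k: "k \<in> {1..n}"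
  shows "(\<Psi> \<longlongrightarrow> \<Psi> (\<tau> k)) (at_left (\<tau> k))"
    and "(\<Psi> \<longlongrightarrow> \<Psi> (\<tau> k) + (0, h01_l2 (\<Upsilon> k))) (at_right (\<tau> k))"
proof -
  from s k obtain r where l: "(\<Psi> \<longlongrightarrow> \<Psi> (\<tau> k)) (at_left (\<tau> k))"
    and r: "(\<Psi> \<longlongrightarrow> r) (at_right (\<tau> k))"
    unfolding classical_solution_def piecewise_continuous_def by (metis image_eqI)
  show "(\<Psi> \<longlongrightarrow> \<Psi> (\<tau> k)) (at_left (\<tau> k))" by (rule l)
  have "Lim (at_left (\<tau> k)) \<Psi> = \<Psi> (\<tau> k)" "Lim (at_right (\<tau> k)) \<Psi> = r"
    by (rule tendsto_Lim[OF _ l], simp) (rule tendsto_Lim[OF _ r], simp)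
  with s k have "r = \<Psi> (\<tau> k) + (0, h01_l2 (\<Upsilon> k))"
    by (auto simp: classical_solution_def)
  with r show "(\<Psi> \<longlongrightarrow> \<Psi> (\<tau> k) + (0, h01_l2 (\<Upsilon> k))) (at_right (\<tau> k))" by simp
qed

lemma classical_solution_unique:
  assumes g: "generates_group wave_domain wave_operator S" and i: "isometries S"
    and 1: "classical_solution T n \<tau> \<Upsilon> \<Psi>\<^sub>0 \<Phi>" and 2: "classical_solution T n \<tau> \<Upsilon> \<Psi>\<^sub>0 \<Psi>"
    and t: "t \<in> {0..T}"
  shows "\<Phi> t = \<Psi> t"
proof -
  define P where "P = \<tau> ` {1..n}"
  define w where "w t = \<Phi> t - \<Psi> t" for t
  have P: "finite P" by (simp add: P_def)
  have "continuous (at s within {0..T}) w" if s: "s \<in> {0..T}" for s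
  proof (cases "s \<in> P")
    case True
    then obtain k where k: "k \<in> {1..n}" "s = \<tau> k" by (auto simp: P_def)
    note l = classical_solution_one_sided_limits[OF 1 k(1)]
      classical_solution_one_sided_limits[OF 2 k(1)]
    \<comment> \<open>Both right limits contain the same impulse, which cancels in the
      difference.\<close>
    have "(w \<longlongrightarrow> w s) (at_left s)" "(w \<longlongrightarrow> w s) (at_right s)"
      using tendsto_diff[OF l(1,3)] tendsto_diff[OF l(2,4)] by (simp_all add: w_def[abs_def] k(2))
    then have "(w \<longlongrightarrow> w s) (at s)" by (rule filterlim_split_at)
    then show ?thesis
      unfolding continuous_within by (rule tendsto_within_subset) simp
  next
    case False
    have "continuous_on ({0..T} - P) w"
      using 1 2 unfolding w_def
      by (intro continuous_on_diff) (auto simp: classical_solution_def piecewise_continuous_def P_def)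
    with s False have "continuous (at s within {0..T} - P) w"
      by (simp add: continuous_on_eq_continuous_within)
    \<comment> \<open>The finite set \<open>P\<close> is closed, so removing it changes nothing near
      a point outside it.\<close>
    moreover have "at s within {0..T} - P = at s within {0..T}"
      using False P by (intro at_within_nhd[where S="- P"]) (auto simp: finite_imp_closed open_Compl)
    ultimately show ?thesis by simp
  qed
  then have "continuous_on {0..T} w" by (simp add: continuous_on_eq_continuous_within)
  then have cont: "continuous_on {0..T} (\<lambda>s. inner (w s) (w s))"
    by (intro continuous_on_inner)
  have der: "((\<lambda>s. inner (w s) (w s)) has_derivative (\<lambda>h. 0)) (at s within {0..T})"
    if s: "s \<in> {0..T} - (P \<union> {0, T})" for s
  proof -
    have s': "s \<in> {0<..<T} - \<tau> ` {1..n}" using s by (auto simp: P_def)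
    with 1 2 have D: "\<Phi> s \<in> wave_domain" "\<Psi> s \<in> wave_domain"
      and d: "(\<Phi> has_vector_derivative wave_operator (\<Phi> s)) (at s)"
        "(\<Psi> has_vector_derivative wave_operator (\<Psi> s)) (at s)"
      unfolding classical_solution_def by blast+
    have "(w has_vector_derivative wave_operator (w s)) (at s)"
      unfolding w_def generator_diff(2)[OF g D] by (intro has_vector_derivative_diff d)
    then have "((\<lambda>s. inner (w s) (w s)) has_derivative
        (\<lambda>h. inner (w s) (h *\<^sub>R wave_operator (w s)) + inner (h *\<^sub>R wave_operator (w s)) (w s))) (at s)"
      unfolding has_vector_derivative_def by (intro has_derivative_inner)
    moreover have "inner (wave_operator (w s)) (w s) = 0"
      unfolding w_def by (rule generator_orthogonal[OF g i generator_diff(1)[OF g D]])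
    ultimately have "((\<lambda>s. inner (w s) (w s)) has_derivative (\<lambda>h. 0)) (at s)"
      by (simp add: inner_commute)
    then show ?thesis by (rule has_derivative_at_withinI)
  qed
  have "w 0 = 0" using 1 2 by (simp add: w_def classical_solution_def)
  then have "inner (w t) (w t) = 0"
    \<comment> \<open>A continuous function whose derivative vanishes off a finite set is constant;
      the exceptional points are the impulse times and both endpoints, so \<open>t = T\<close> is
      covered by continuity.\<close>
    using P by (intro has_derivative_zero_unique_strong_interval[OF _ cont _ der t, of "P \<union> {0, T}"]) auto
  then show ?thesis by (simp add: w_def)
qed

section \<open>Existence and the solution formula\<close>

text \<open>With delayed orbits the index range of the sum no longer depends on \<open>t\<close>, so
  each requirement can be checked summand by summand.\<close>

lemma classical_solution_Duhamel:
  assumes mono: "strict_mono_on {0..n} \<tau>"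
    and g: "generates_group wave_domain wave_operator S" and x: "x \<in> wave_domain"
    and pos: "\<And>k. k \<in> {1..n} \<Longrightarrow> 0 < \<tau> k"
  shows "classical_solution T n \<tau> \<Upsilon> x
    (\<lambda>t. S t x + (\<Sum>k=1..n. delayed_orbit S (\<tau> k) (0, h01_l2 (\<Upsilon> k)) t))"
proof -
  define P where "P = \<tau> ` {1..n}"
  define b where "b k = (0 :: h01, h01_l2 (\<Upsilon> k))" for k
  define \<Psi> where "\<Psi> t = S t x + (\<Sum>k=1..n. delayed_orbit S (\<tau> k) (b k) t)" for t
  note C = generates_group_C0[OF g]
  have b: "b k \<in> wave_domain" for k by (simp add: b_def wave_domain_velocity)
  \<comment> \<open>Stated for arbitrary vectors because it serves both the solution and its
    derivative.\<close>
  have off: "isCont (\<lambda>t. S t y + (\<Sum>k=1..n. delayed_orbit S (\<tau> k) (c k) t)) t" if "t \<notin> P" for y c t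
    using that unfolding P_def
    by (intro isCont_add isCont_sum C0_group_isCont[OF C] ballI isCont_delayed_orbit[OF C]) blast
  have left: "(\<Psi> \<longlongrightarrow> \<Psi> t) (at_left t)" for t
    unfolding \<Psi>_def
    by (intro tendsto_add tendsto_sum delayed_orbit_at_left[OF C]
        tendsto_within_subset[OF C0_group_isCont[OF C, unfolded isCont_def]]) simp
  have right: "(\<Psi> \<longlongrightarrow> \<Psi> (\<tau> m) + b m) (at_right (\<tau> m))" if m: "m \<in> {1..n}" for m
  proof -
    have "((\<lambda>t. S t x + (\<Sum>k=1..n. delayed_orbit S (\<tau> k) (b k) t)) \<longlongrightarrow>
       S (\<tau> m) x + (\<Sum>k=1..n. delayed_orbit S (\<tau> k) (b k) (\<tau> m) + (if \<tau> k = \<tau> m then b k else 0)))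
       (at_right (\<tau> m))"
      by (intro tendsto_add tendsto_sum delayed_orbit_at_right[OF C]
          tendsto_within_subset[OF C0_group_isCont[OF C, unfolded isCont_def]]) simp
    \<comment> \<open>The impulse times are distinct, so exactly one summand jumps at
      \<open>\<tau> m\<close>.\<close>
    moreover have "(\<Sum>k=1..n. if \<tau> k = \<tau> m then b k else 0) = (\<Sum>k=1..n. if k = m then b k else 0)"
      using m inj_on_eq_iff[OF strict_mono_on_imp_inj_on[OF mono]] by (intro sum.cong) auto
    ultimately show ?thesis using m by (simp add: \<Psi>_def[abs_def] sum.distrib add.assoc)
  qed
  have D: "\<Psi> t \<in> wave_domain" for t
    unfolding \<Psi>_def
    by (intro generator_add(1)[OF g] generator_sum(1)[OF g] generator_orbit(1)[OF g x]
        delayed_orbit_in_domain(1)[OF g b])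
  \<comment> \<open>The same formula with the generator applied to the initial vector and to the
    impulses: it is the derivative off \<open>P\<close> and equals the generator applied to the
    solution.\<close>
  define \<Psi>' where
    "\<Psi>' t = S t (wave_operator x) + (\<Sum>k=1..n. delayed_orbit S (\<tau> k) (wave_operator (b k)) t)" for t
  have A: "wave_operator (\<Psi> t) = \<Psi>' t" for t
    unfolding \<Psi>_def \<Psi>'_def
    by (simp add: generator_add(2)[OF g] generator_sum[OF g] generator_orbit(1,2)[OF g x]
        delayed_orbit_in_domain[OF g b])
  have der: "(\<Psi> has_vector_derivative \<Psi>' t) (at t)" if "t \<notin> P" for t
    unfolding \<Psi>_def[abs_def] \<Psi>'_def using that
    by (intro has_vector_derivative_add has_vector_derivative_sum generator_orbit(3)[OF g x]
        delayed_orbit_has_vector_derivative[OF g b]) (auto simp: P_def)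
  have pc: "piecewise_continuous T P \<Psi>"
    unfolding piecewise_continuous_def
  proof (intro conjI ballI)
    show "continuous_on ({0..T} - P) \<Psi>"
      unfolding \<Psi>_def[abs_def] by (intro continuous_at_imp_continuous_on ballI off) simp
    fix p assume "p \<in> P"
    then obtain m where "m \<in> {1..n}" "p = \<tau> m" by (auto simp: P_def)
    then show "\<exists>l r. (\<Psi> \<longlongrightarrow> l) (at_left p) \<and> (\<Psi> \<longlongrightarrow> r) (at_right p) \<and> \<Psi> p = l"
      using left[of p] right[of m] by blast
  qed
  have "continuous_on ({0<..<T} - P) \<Psi>'"
    unfolding \<Psi>'_def[abs_def] by (intro continuous_at_imp_continuous_on ballI off) simp
  then have c1: "\<Psi> C1_differentiable_on ({0<..<T} - P)"
    unfolding C1_differentiable_on_def using der by blast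
  have jump: "Lim (at_right (\<tau> k)) \<Psi> = Lim (at_left (\<tau> k)) \<Psi> + b k" if "k \<in> {1..n}" for k
    using tendsto_Lim[OF _ left[of "\<tau> k"]] tendsto_Lim[OF _ right[OF that]] by simp
  have "delayed_orbit S (\<tau> k) (b k) 0 = 0" if "k \<in> {1..n}" for k
    using pos[OF that] by (simp add: delayed_orbit_def)
  then have "\<Psi> 0 = x" by (simp add: \<Psi>_def C0_group_zero[OF C])
  with pc c1 D der A jump have "classical_solution T n \<tau> \<Upsilon> x \<Psi>"
    by (simp add: classical_solution_def P_def b_def)
  then show ?thesis by (simp add: \<Psi>_def[abs_def] b_def)
qed

theorem proposition2p1:
  fixes T :: real and n :: nat and \<tau> :: "nat \<Rightarrow> real"
    and \<kappa>\<^sub>0 :: h01 and \<kappa>\<^sub>1 :: l2 and \<Upsilon> :: "nat \<Rightarrow> h01"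
    and S :: "real \<Rightarrow> energy_space \<Rightarrow> energy_space"
  assumes "0 < T" and "\<tau> 0 = 0" and "strict_mono_on {0..n} \<tau>" and "\<tau> n < T"
    and "generates_group wave_domain wave_operator S" and "isometries S"
    and "(\<kappa>\<^sub>0, \<kappa>\<^sub>1) \<in> wave_domain"
  shows "\<exists>\<Psi>. classical_solution T n \<tau> \<Upsilon> (\<kappa>\<^sub>0, \<kappa>\<^sub>1) \<Psi> \<and>
    (\<forall>\<Phi>. classical_solution T n \<tau> \<Upsilon> (\<kappa>\<^sub>0, \<kappa>\<^sub>1) \<Phi> \<longrightarrow> (\<forall>t\<in>{0..T}. \<Phi> t = \<Psi> t)) \<and>
    (\<forall>t\<in>{0..<T}. \<Psi> t = S t (\<kappa>\<^sub>0, \<kappa>\<^sub>1) +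
      (\<Sum>k | k \<in> {1..n} \<and> 0 < \<tau> k \<and> \<tau> k < t. S (t - \<tau> k) (0, h01_l2 (\<Upsilon> k))))"
proof -
  let ?x = "(\<kappa>\<^sub>0, \<kappa>\<^sub>1)" and ?b = "\<lambda>k. (0, h01_l2 (\<Upsilon> k))"
  define \<Psi> where "\<Psi> t = S t ?x + (\<Sum>k=1..n. delayed_orbit S (\<tau> k) (?b k) t)" for t
  have pos: "0 < \<tau> k" if "k \<in> {1..n}" for k
    using strict_mono_onD[OF assms(3), of 0 k] that assms(2) by simp
  have sol: "classical_solution T n \<tau> \<Upsilon> ?x \<Psi>"
    unfolding \<Psi>_def[abs_def]
    by (rule classical_solution_Duhamel[OF assms(3,5,7) pos])
  \<comment> \<open>Delayed orbits with \<open>t \<le> \<tau> k\<close> vanish, which leaves the sum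
    over the impulses strictly before \<open>t\<close>.\<close>
  have "(\<Sum>k=1..n. delayed_orbit S (\<tau> k) (?b k) t) =
      (\<Sum>k | k \<in> {1..n} \<and> 0 < \<tau> k \<and> \<tau> k < t. S (t - \<tau> k) (?b k))" for t
    using pos by (intro sum.mono_neutral_cong_right) (auto simp: delayed_orbit_def)
  then have "\<Psi> t = S t ?x + (\<Sum>k | k \<in> {1..n} \<and> 0 < \<tau> k \<and> \<tau> k < t. S (t - \<tau> k) (?b k))" for t
    by (simp add: \<Psi>_def)
  with sol classical_solution_unique[OF assms(5,6) _ sol] show ?thesis by blast
qed

end
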